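(* Let $A$ be a finite dimensional (not necessarily associative) algebra over a field of characteristic $0$ graded by a set $T$ such that $A$ does not have non-trivial graded ideals. Then the limit $\mathrm{PIexp}^{T\text{-}\mathrm{gr}}(A)=\lim_{n\to\infty}\sqrt[n]{c_n^{T\text{-}\mathrm{gr}}(A)}$ exists.
   Context: Let $T$ be a set and $F$ a field. An algebra $A$ over $F$ (not necessarily associative) is graded by $T$ ($T$-graded) if a decomposition $A=\bigoplus_{t\in T}A^{(t)}$ into a direct sum of subspaces is fixed such that for every $s,t\in T$ there exists $r\in T$ with $A^{(s)}A^{(t)}\subseteq A^{(r)}$ (no operation on $T$ is assumed). A graded ideal is a two-sided ideal $I$ with $I=\bigoplus_{t\in T}(I\cap A^{(t)})$; it is non-trivial if $I\ne 0$ and $I\neq A$. Let $F\{X^{T\text{-}\mathrm{gr}}\}$ be the absolutely free non-associative $F$-algebra on the disjoint union $X^{T\text{-}\mathrm{gr}}=\bigsqcup_{t\in T}X^{(t)}$, $X^{(t)}=\{x_1^{(t)},x_2^{(t)},\dots\}$. An element $f=f(x_{i_1}^{(t_1)},\dots,x_{i_s}^{(t_s)})$ is a graded polynomial identity of $A$ if $f(a_1,\dots,a_s)=0$ for all $a_j\in A^{(t_j)}$; the ideal of these is $\mathrm{Id}^{T\text{-}\mathrm{gr}}(A)$. Let $W_n^{T\text{-}\mathrm{gr}}$ be the span of all $x_{\sigma(1)}^{(t_1)}\cdots x_{\sigma(n)}^{(t_n)}$, $t_i\in T$, $\sigma\in S_n$, with all arrangements of brackets. The $n$th graded codimension is $c_n^{T\text{-}\mathrm{gr}}(A):=\dim\frac{W_n^{T\text{-}\mathrm{gr}}}{W_n^{T\text{-}\mathrm{gr}}\cap\mathrm{Id}^{T\text{-}\mathrm{gr}}(A)}$.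 *)

theory Defs
  imports Complex_Main "HOL-Library.Poly_Mapping" "HOL-Combinatorics.Permutations"
begin

section \<open>Direct sums and quotients of vector spaces\<close>

definition quotient_space :: "'b::ab_group_add set \<Rightarrow> 'b set \<Rightarrow> 'b set set" where
  "quotient_space W U = (\<lambda>w. (+) w ` U) ` W"

context vector_space
begin

text \<open>The direct sum is internal: every vector of \<open>W\<close> has exactly one finitely supported
  decomposition. The family is only relevant on \<open>T\<close>, so decompositions vanish outside \<open>T\<close>.\<close>

definition direct_sum :: "'t set \<Rightarrow> ('t \<Rightarrow> 'b set) \<Rightarrow> 'b set \<Rightarrow> bool" where
  "direct_sum T V W \<longleftrightarrow>
     subspace W \<and> (\<forall>t\<in>T. subspace (V t) \<and> V t \<subseteq> W) \<and>
     (\<forall>w\<in>W. \<exists>!g. (\<forall>t\<in>T. g t \<in> V t) \<and> (\<forall>t. t \<notin> T \<longrightarrow> g t = 0) \<and>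
        finite {t. g t \<noteq> 0} \<and> w = (\<Sum>t | g t \<noteq> 0. g t))"

text \<open>The linear combination, in the quotient by the subspace \<open>U\<close>, of the cosets in the finite
  set \<open>S\<close>. The extra summand from \<open>U\<close> makes the result a full coset also when \<open>S\<close> is empty
  or all coefficients vanish.\<close>

definition quotient_comb :: "'b set \<Rightarrow> ('b set \<Rightarrow> 'a) \<Rightarrow> 'b set set \<Rightarrow> 'b set" where
  "quotient_comb U c S = {u + (\<Sum>X\<in>S. c X *s r X) | u r. u \<in> U \<and> (\<forall>X\<in>S. r X \<in> X)}"

definition quotient_basis :: "'b set \<Rightarrow> 'b set \<Rightarrow> 'b set set \<Rightarrow> bool" where
  "quotient_basis W U B \<longleftrightarrow>
     B \<subseteq> quotient_space W U \<and>
     (\<forall>S c. finite S \<and> S \<subseteq> B \<and> local.quotient_comb U c S = U \<longrightarrow> (\<forall>X\<in>S. c X = 0)) \<and>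
     (\<forall>Y\<in>quotient_space W U. \<exists>S c. finite S \<and> S \<subseteq> B \<and> Y = local.quotient_comb U c S)"

text \<open>As for \<^const>\<open>dim\<close>, an infinite dimension is reported as \<open>0\<close>. The graded codimensions of a
  finite dimensional algebra are finite, so this convention plays no role for them.\<close>

definition quotient_dim :: "'b set \<Rightarrow> 'b set \<Rightarrow> nat" where
  "quotient_dim W U =
     (if \<exists>B. finite B \<and> local.quotient_basis W U B
      then card (SOME B. finite B \<and> local.quotient_basis W U B) else 0)"

end

section \<open>Algebras graded by a set\<close>

locale nonassoc_algebra = vector_space scale
  for scale :: "'f::field \<Rightarrow> 'a::ab_group_add \<Rightarrow> 'a" +
  fixes mult :: "'a \<Rightarrow> 'a \<Rightarrow> 'a"
  assumes mult_add_left: "mult (a + b) c = mult a c + mult b c"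
    and mult_add_right: "mult a (b + c) = mult a b + mult a c"
    and mult_scale_left: "mult (scale k a) b = scale k (mult a b)"
    and mult_scale_right: "mult a (scale k b) = scale k (mult a b)"

locale graded_algebra = nonassoc_algebra scale mult
  for scale :: "'f::field \<Rightarrow> 'a::ab_group_add \<Rightarrow> 'a" and mult :: "'a \<Rightarrow> 'a \<Rightarrow> 'a" +
  fixes T :: "'t set" and A :: "'t \<Rightarrow> 'a set"
  assumes direct_sum_components: "direct_sum T A UNIV"
    and mult_components:
      "\<lbrakk>s \<in> T; t \<in> T\<rbrakk> \<Longrightarrow> \<exists>r\<in>T. \<forall>a\<in>A s. \<forall>b\<in>A t. mult a b \<in> A r"
begin

definition graded_ideal :: "'a set \<Rightarrow> bool" where
  "graded_ideal I \<longleftrightarrow>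
     subspace I \<and> (\<forall>a. \<forall>x\<in>I. mult a x \<in> I \<and> mult x a \<in> I) \<and>
     direct_sum T (\<lambda>t. I \<inter> A t) I"

definition nontrivial_graded_ideal :: "'a set \<Rightarrow> bool" where
  "nontrivial_graded_ideal I \<longleftrightarrow> graded_ideal I \<and> I \<noteq> {0} \<and> I \<noteq> UNIV"

end

section \<open>The absolutely free non-associative algebra\<close>

text \<open>The bracketed monomials form the free magma on the variables \<open>'v\<close>. The free algebra is the
  space \<open>'v monomial \<Rightarrow>\<^sub>0 'f\<close> of finitely supported functions on it, and substituting elements of an
  algebra for the variables (\<open>eval_poly\<close> below) is the linear extension of the magma homomorphism
  \<open>eval_monomial\<close>.\<close>

datatype 'v monomial = Var 'v | Prod "'v monomial" "'v monomial"

primrec letters :: "'v monomial \<Rightarrow> 'v list" where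
  "letters (Var v) = [v]"
| "letters (Prod p q) = letters p @ letters q"

primrec eval_monomial :: "('a \<Rightarrow> 'a \<Rightarrow> 'a) \<Rightarrow> ('v \<Rightarrow> 'a) \<Rightarrow> 'v monomial \<Rightarrow> 'a" where
  "eval_monomial mul \<rho> (Var v) = \<rho> v"
| "eval_monomial mul \<rho> (Prod p q) = mul (eval_monomial mul \<rho> p) (eval_monomial mul \<rho> q)"

definition eval_poly ::
  "('f::field \<Rightarrow> 'a::ab_group_add \<Rightarrow> 'a) \<Rightarrow> ('a \<Rightarrow> 'a \<Rightarrow> 'a) \<Rightarrow> ('v \<Rightarrow> 'a) \<Rightarrow> ('v monomial \<Rightarrow>\<^sub>0 'f) \<Rightarrow> 'a"
  where "eval_poly scale mul \<rho> f =
    (\<Sum>m\<in>Poly_Mapping.keys f. scale (Poly_Mapping.lookup f m) (eval_monomial mul \<rho> m))"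

definition free_scale :: "'f::field \<Rightarrow> ('m \<Rightarrow>\<^sub>0 'f) \<Rightarrow> ('m \<Rightarrow>\<^sub>0 'f)" where
  "free_scale c f = Poly_Mapping.map ((*) c) f"

lemma lookup_free_scale [simp]: "Poly_Mapping.lookup (free_scale c f) m = c * Poly_Mapping.lookup f m"
  by (simp add: free_scale_def map.rep_eq when_def)

interpretation free: vector_space "free_scale :: 'f::field \<Rightarrow> ('m \<Rightarrow>\<^sub>0 'f) \<Rightarrow> ('m \<Rightarrow>\<^sub>0 'f)"
  by unfold_locales (auto intro!: poly_mapping_eqI simp: lookup_add algebra_simps)

section \<open>Graded polynomial identities and codimensions\<close>

text \<open>The pair \<open>(t, i)\<close> stands for the variable $x_i^{(t)}$, with indices starting from 1.\<close>

definition graded_variables :: "'t set \<Rightarrow> ('t \<times> nat) set" where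
  "graded_variables T = T \<times> {1..}"

definition graded_free_algebra :: "'t set \<Rightarrow> (('t \<times> nat) monomial \<Rightarrow>\<^sub>0 'f::field) set" where
  "graded_free_algebra T = {f. \<forall>m\<in>Poly_Mapping.keys f. set (letters m) \<subseteq> graded_variables T}"

definition multilinear_monomials :: "'t set \<Rightarrow> nat \<Rightarrow> ('t \<times> nat) monomial set" where
  "multilinear_monomials T n =
     {m. \<exists>\<sigma> \<tau>. \<sigma> permutes {1..n} \<and> (\<forall>i\<in>{1..n}. \<tau> i \<in> T) \<and>
        letters m = map (\<lambda>i. (\<tau> i, \<sigma> i)) [1..<Suc n]}"

definition multilinear_space :: "'t set \<Rightarrow> nat \<Rightarrow> (('t \<times> nat) monomial \<Rightarrow>\<^sub>0 'f::field) set" where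
  "multilinear_space T n = free.span ((\<lambda>m. Poly_Mapping.single m 1) ` multilinear_monomials T n)"

context graded_algebra
begin

definition graded_identities :: "(('t \<times> nat) monomial \<Rightarrow>\<^sub>0 'f) set" where
  "graded_identities =
     {f \<in> graded_free_algebra T.
        \<forall>\<rho>. (\<forall>(t, i)\<in>graded_variables T. \<rho> (t, i) \<in> A t) \<longrightarrow> eval_poly scale mult \<rho> f = 0}"

definition graded_codimension :: "nat \<Rightarrow> nat" where
  "graded_codimension n =
     free.quotient_dim (multilinear_space T n) (multilinear_space T n \<inter> graded_identities)"

end

end

theory Submission
  imports Defs "HOL-Library.Function_Algebras" "HOL-Real_Asymp.Real_Asymp"
begin

text \<open>The $n$th codimension is the dimension of the space $V_n$ of functions $A^n \to A$ given by the
  multilinear graded polynomials. It satisfies $c_m c_n \le C\, c_{m+n+K}$ with constants $C$ and $K$,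
  so a variant of Fekete's lemma gives the limit; no representation theory of $S_n$ is needed.

  Up to the factor $\dim A$, the dimension of $V_m$ is the length of a longest triangular system:
  functions $f_i \in V_m$ and homogeneous points $x_i$ such that $f_i(x_i) \neq 0$ is homogeneous and
  $f_i(x_k) = 0$ for $k < i$. Take another such system $g_j$, $y_j$ in $V_n$. As $A$ is graded-simple
  and $A^2 \neq 0$, any nonzero homogeneous $a$ and $b$ admit a product $w_3(w_1(a)\, w_2(b))$ that
  does not vanish, where the $w_i$ are multiplications by altogether $K = 2 \dim A$ homogeneous
  elements. Each pair $(i, j)$ thus yields a function in $V_{m+n+K}$ that does not vanish at
  $(x_i, y_j)$ for suitable values of the $K$ new variables. There are finitely many shapes of $w$,
  and the functions of one shape are linearly independent, being triangular for the product order
  on pairs.\<close>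

section \<open>Linear algebra\<close>

context vector_space_pair
begin

text \<open>Rank-nullity phrased with independent sets: \<open>S'\<close> is a basis of the kernel
  of \<open>f\<close> on \<open>span S\<close>, and the image has dimension at most
  \<open>card Y\<close>. No finite dimension of the ambient spaces enters, so it applies to spaces
  of functions.\<close>

lemma independent_kernel:
  assumes f: "Vector_Spaces.linear s1 s2 f" and S: "finite S" "vs1.independent S"
    and Y: "finite Y" "f ` S \<subseteq> vs2.span Y"
  obtains S' where "finite S'" "vs1.independent S'" "S' \<subseteq> vs1.span S" "\<And>x. x \<in> S' \<Longrightarrow> f x = 0"
    "card S \<le> card S' + card Y"
proof -
  interpret f: Vector_Spaces.linear s1 s2 f by fact
  define K where "K = vs1.span S \<inter> {x. f x = 0}"
  have sK: "vs1.subspace K"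
    unfolding K_def by (intro vs1.subspace_inter vs1.subspace_span f.subspace_kernel)
  obtain S' where S': "S' \<subseteq> K" "vs1.independent S'" "K \<subseteq> vs1.span S'"
    using vs1.maximal_independent_subset by blast
  have finS': "finite S'"
    using vs1.independent_span_bound[OF S(1) S'(2)] S'(1) K_def by blast
  obtain B where B: "B \<subseteq> f ` S" "vs2.independent B" "f ` S \<subseteq> vs2.span B"
    using vs2.maximal_independent_subset by blast
  have finB: "finite B" "card B \<le> card Y"
    using vs2.independent_span_bound[OF Y(1) B(2)] B(1) Y(2) by auto
  obtain S0 where S0: "S0 \<subseteq> S" "B = f ` S0" "inj_on f S0"
    using B(1) subset_image_inj by metis
  have "finite S0" using S0 S finite_subset by blast
  \<comment> \<open>\<open>S0\<close> consists of preimages of a basis of the image, so each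
    \<open>x\<close> differs from some element of \<open>span S0\<close> by an element of the
    kernel.\<close>
  have "S \<subseteq> vs1.span (S0 \<union> S')"
  proof
    fix x assume x: "x \<in> S"
    have "f x \<in> f ` vs1.span S0"
      using B(3) x S0(2) f.span_image by blast
    then obtain h where h: "h \<in> vs1.span S0" "f x = f h" by blast
    have "x - h \<in> K"
      unfolding K_def using h vs1.span_base[OF x] vs1.span_mono[OF S0(1)]
      by (auto simp: f.diff intro: vs1.span_diff)
    then have "x - h \<in> vs1.span (S0 \<union> S')"
      using S'(3) vs1.span_mono[of S' "S0 \<union> S'"] by blast
    moreover have "h \<in> vs1.span (S0 \<union> S')"
      using h vs1.span_mono[of S0 "S0 \<union> S'"] by blast
    ultimately show "x \<in> vs1.span (S0 \<union> S')"
      using vs1.span_add by force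
  qed
  then have "card S \<le> card (S0 \<union> S')"
    using vs1.independent_span_bound[OF _ S(2)] \<open>finite S0\<close> finS' by blast
  also have "\<dots> \<le> card S0 + card S'" by (rule card_Un_le)
  also have "card S0 = card B" using S0 by (simp add: card_image)
  finally have "card S \<le> card S' + card Y" using finB by linarith
  then show thesis
    using that finS' S' K_def by blast
qed

text \<open>Each map costs at most \<open>card Y\<close> dimensions. With evaluations as the maps,
  this produces functions that vanish at finitely many prescribed points.\<close>

lemma independent_kernels:
  assumes f: "\<And>p. p \<in> P \<Longrightarrow> Vector_Spaces.linear s1 s2 (f p)" and P: "finite P"
    and S: "finite S" "vs1.independent S" and Y: "finite Y" "vs2.span Y = UNIV"
  obtains S' where "finite S'" "vs1.independent S'" "S' \<subseteq> vs1.span S"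
    "\<forall>x\<in>S'. \<forall>p\<in>P. f p x = 0" "card S \<le> card S' + card P * card Y"
  using P f
proof (induction P arbitrary: thesis rule: finite_induct)
  case empty
  then show ?case using S vs1.span_superset by auto
next
  case (insert p P)
  obtain S' where S': "finite S'" "vs1.independent S'" "S' \<subseteq> vs1.span S"
    "\<forall>x\<in>S'. \<forall>p\<in>P. f p x = 0" "card S \<le> card S' + card P * card Y"
    using insert.IH insert.prems(2) by blast
  have "Vector_Spaces.linear s1 s2 (f p)" using insert.prems by blast
  from independent_kernel[OF this S'(1,2) Y(1)] Y(2) obtain S'' where
    S'': "finite S''" "vs1.independent S''" "S'' \<subseteq> vs1.span S'" "\<And>x. x \<in> S'' \<Longrightarrow> f p x = 0"
      "card S' \<le> card S'' + card Y" by auto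
  show ?case
  proof (rule insert.prems(1)[OF S''(1,2)])
    show "S'' \<subseteq> vs1.span S"
      using S''(3) vs1.span_minimal[OF S'(3)] by auto
  next
    have "f q x = 0" if x: "x \<in> S''" and q: "q \<in> insert p P" for x q
    proof (cases "q = p")
      case False
      then have "q \<in> P" using q by simp
      then interpret q: Vector_Spaces.linear s1 s2 "f q" using insert.prems by blast
      show ?thesis using q.eq_0_on_span[of S' x] S'(4) \<open>q \<in> P\<close> S''(3) x by blast
    qed (use S''(4) x in simp)
    then show "\<forall>x\<in>S''. \<forall>q\<in>insert p P. f q x = 0" by blast
  next
    show "card S \<le> card S'' + card (insert p P) * card Y"
      using S'(5) S''(5) insert.hyps by simp
  qed
qed

text \<open>In a linear relation, choose an index \<open>a\<close> of least \<open>\<mu>\<close>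
  among those with nonzero coefficient; applying \<open>e a\<close> kills every other term. Distinct
  indices may share a value of \<open>\<mu>\<close>, so a partial order can be handled through a
  rank function.\<close>

lemma triangular_independent:
  fixes \<mu> :: "'i \<Rightarrow> nat"
  assumes e: "\<And>a. a \<in> I \<Longrightarrow> Vector_Spaces.linear s1 s2 (e a)"
    and nz: "\<And>a. a \<in> I \<Longrightarrow> e a (H a) \<noteq> 0"
    and tri: "\<And>a b. a \<in> I \<Longrightarrow> b \<in> I \<Longrightarrow> b \<noteq> a \<Longrightarrow> \<mu> a \<le> \<mu> b \<Longrightarrow> e a (H b) = 0"
    and I: "finite I"
  shows "vs1.independent (H ` I)" "card (H ` I) = card I"
proof -
  have inj: "inj_on H I"
  proof (rule inj_onI, rule ccontr)
    fix a b assume *: "a \<in> I" "b \<in> I" "H a = H b" "a \<noteq> b"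
    show False
      using tri[of a b] tri[of b a] nz[of a] nz[of b] * by (cases "\<mu> a \<le> \<mu> b") auto
  qed
  then show "card (H ` I) = card I" by (rule card_image)
  show "vs1.independent (H ` I)"
  proof
    assume "vs1.dependent (H ` I)"
    then obtain u where u: "\<exists>v\<in>H ` I. u v \<noteq> 0" "(\<Sum>v\<in>H ` I. s1 (u v) v) = 0"
      using vs1.dependent_finite[of "H ` I"] I by auto
    from u(2) have s: "(\<Sum>b\<in>I. s1 (u (H b)) (H b)) = 0"
      using inj by (simp add: sum.reindex)
    define N where "N = {a \<in> I. u (H a) \<noteq> 0}"
    have "N \<noteq> {}" using u(1) N_def by auto
    then obtain a where a: "a \<in> N" "\<And>b. b \<in> N \<Longrightarrow> \<mu> a \<le> \<mu> b"
      using ex_has_least_nat[of "\<lambda>x. x \<in> N" _ \<mu>] by blast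
    have aI: "a \<in> I" using a N_def by auto
    interpret ea: Vector_Spaces.linear s1 s2 "e a" using e aI by blast
    have "0 = e a (\<Sum>b\<in>I. s1 (u (H b)) (H b))" by (simp add: s)
    also have "\<dots> = (\<Sum>b\<in>I. s2 (u (H b)) (e a (H b)))"
      by (simp add: ea.sum ea.scale)
    also have "\<dots> = s2 (u (H a)) (e a (H a))"
    proof -
      have z: "s2 (u (H b)) (e a (H b)) = 0" if "b \<in> I" "b \<noteq> a" for b
        using tri[of a b] a(2)[of b] that aI N_def by (cases "u (H b) = 0") auto
      show ?thesis
        by (subst sum.remove[OF I aI]) (use z in \<open>simp add: sum.neutral\<close>)
    qed
    finally show False using nz[OF aI] a(1) N_def by simp
  qed
qed

lemma quotient_dim_kernel:
  assumes f: "Vector_Spaces.linear s1 s2 f" and W: "vs1.subspace W" and U: "U = W \<inter> {x. f x = 0}"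
    and Y: "finite Y" "f ` W \<subseteq> vs2.span Y"
  shows "vs1.quotient_dim W U = vs2.dim (f ` W)"
proof -
  interpret f: Vector_Spaces.linear s1 s2 f by fact
  define Q where "Q = quotient_space W U"
  define C where "C y = {x \<in> W. f x = y}" for y
  define g where "g X = f (SOME x. x \<in> X)" for X
  have coset: "(+) w ` U = C (f w)" if "w \<in> W" for w
  proof (intro equalityI subsetI)
    fix x assume "x \<in> C (f w)"
    then have "x - w \<in> U" using that W by (auto simp: C_def U f.diff intro: vs1.subspace_diff)
    then show "x \<in> (+) w ` U" by (metis add_diff_cancel_left' diff_add_cancel image_eqI add.commute)
  qed (use that W in \<open>auto simp: C_def U f.add intro: vs1.subspace_add\<close>)
  have Q: "Q = C ` f ` W"
    unfolding Q_def quotient_space_def image_image by (rule image_cong) (auto simp: coset)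
  have gC: "g (C y) = y" if "y \<in> f ` W" for y
  proof -
    have "(SOME x. x \<in> C y) \<in> C y" using that by (intro someI_ex[of "\<lambda>x. x \<in> C y"]) (auto simp: C_def)
    then show ?thesis by (simp add: g_def C_def)
  qed
  have gQ: "g X \<in> f ` W" "C (g X) = X" if "X \<in> Q" for X
    using that gC by (auto simp: Q)
  have U0: "U = C 0" by (auto simp: U C_def)
  have C_inj: "y = y'" if "C y = C y'" "y \<in> f ` W" for y y'
    using that by (auto simp: C_def)
  have sW: "vs2.subspace (f ` W)" using f.subspace_image W by blast
  have comb_in: "(\<Sum>X\<in>S. s2 (c X) (g X)) \<in> f ` W" if "S \<subseteq> Q" for S c
    using that gQ by (intro vs2.subspace_sum[OF sW] vs2.subspace_scale[OF sW]) auto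
  have comb: "vs1.quotient_comb U c S = C (\<Sum>X\<in>S. s2 (c X) (g X))" if "S \<subseteq> Q" "finite S" for S c
  proof (intro equalityI subsetI)
    fix x assume "x \<in> vs1.quotient_comb U c S"
    then obtain u r where x: "x = u + (\<Sum>X\<in>S. s1 (c X) (r X))" "u \<in> U" "\<forall>X\<in>S. r X \<in> X"
      unfolding vs1.quotient_comb_def by auto
    have r: "r X \<in> W \<and> f (r X) = g X" if "X \<in> S" for X
      using x(3) gQ(2)[of X] that \<open>S \<subseteq> Q\<close> by (auto simp: C_def)
    have "x \<in> W" unfolding x(1)
      using x(2) U r by (intro vs1.subspace_add[OF W] vs1.subspace_sum[OF W] vs1.subspace_scale[OF W]) auto
    moreover have "f x = (\<Sum>X\<in>S. s2 (c X) (g X))"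
      unfolding x(1) using x(2) U r by (simp add: f.add f.sum f.scale)
    ultimately show "x \<in> C (\<Sum>X\<in>S. s2 (c X) (g X))" by (simp add: C_def)
  next
    fix x assume x: "x \<in> C (\<Sum>X\<in>S. s2 (c X) (g X))"
    have "\<exists>z. z \<in> W \<and> f z = g X" if "X \<in> S" for X
    proof -
      have "X \<in> Q" using that \<open>S \<subseteq> Q\<close> by blast
      then show ?thesis using gQ(1) by (metis imageE)
    qed
    then obtain r where r: "\<And>X. X \<in> S \<Longrightarrow> r X \<in> W \<and> f (r X) = g X" by metis
    then have rX: "r X \<in> X" if "X \<in> S" for X
      using gQ(2)[of X] that \<open>S \<subseteq> Q\<close> by (auto simp: C_def)
    \<comment> \<open>The error made by choosing representatives lies in the kernel; it is absorbed
      by the extra summand from \<open>U\<close> in \<open>quotient_comb\<close>.\<close>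
    define u where "u = x - (\<Sum>X\<in>S. s1 (c X) (r X))"
    have "u \<in> W"
      unfolding u_def using x r C_def
      by (intro vs1.subspace_diff[OF W] vs1.subspace_sum[OF W] vs1.subspace_scale[OF W]) auto
    then have "u \<in> U"
      using x r by (simp add: U u_def C_def f.diff f.sum f.scale)
    then show "x \<in> vs1.quotient_comb U c S"
      unfolding vs1.quotient_comb_def using rX by (auto simp: u_def intro!: exI[of _ u] exI[of _ r])
  qed
  have comb_0: "vs1.quotient_comb U c S = U \<longleftrightarrow> (\<Sum>X\<in>S. s2 (c X) (g X)) = 0"
    if "S \<subseteq> Q" "finite S" for S c
  proof -
    have "C (\<Sum>X\<in>S. s2 (c X) (g X)) = C 0 \<longleftrightarrow> (\<Sum>X\<in>S. s2 (c X) (g X)) = 0"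
      by (rule iffI, erule C_inj[OF _ comb_in[OF that(1)]]) simp
    then show ?thesis by (subst comb[OF that], subst U0)
  qed
  have g_inj: "inj_on g Q" using gQ by (metis inj_onI)
  \<comment> \<open>\<open>quotient_dim\<close> selects a basis by \<open>SOME\<close>, so every
    finite quotient basis has to have this cardinality.\<close>
  have card_eq: "card B = vs2.dim (f ` W)" if B: "finite B" "vs1.quotient_basis W U B" for B
  proof -
    have BQ: "B \<subseteq> Q" using B by (simp add: vs1.quotient_basis_def Q_def)
    have gi: "inj_on g B" using g_inj BQ inj_on_subset by blast
    have "vs2.independent (g ` B)"
    proof
      assume "vs2.dependent (g ` B)"
      then obtain u where u: "\<exists>v\<in>g ` B. u v \<noteq> 0" "(\<Sum>v\<in>g ` B. s2 (u v) v) = 0"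
        using vs2.dependent_finite[of "g ` B"] B by auto
      then have "(\<Sum>X\<in>B. s2 (u (g X)) (g X)) = 0" using gi by (simp add: sum.reindex)
      then have "vs1.quotient_comb U (\<lambda>X. u (g X)) B = U"
        using comb_0[OF BQ B(1), of "\<lambda>X. u (g X)"] by simp
      then have "\<forall>X\<in>B. u (g X) = 0"
        using B unfolding vs1.quotient_basis_def
        by (auto dest!: spec[where x = B] dest: spec[where x = "\<lambda>X. u (g X)"])
      then show False using u(1) by auto
    qed
    moreover have "f ` W \<subseteq> vs2.span (g ` B)"
    proof
      fix y assume y: "y \<in> f ` W"
      then have "C y \<in> quotient_space W U" using Q Q_def by auto
      then obtain S c where S: "finite S" "S \<subseteq> B" "C y = vs1.quotient_comb U c S"
        using B unfolding vs1.quotient_basis_def by meson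
      then have "y = (\<Sum>X\<in>S. s2 (c X) (g X))"
        using C_inj[OF _ y] comb BQ by (metis subset_trans)
      also have "\<dots> \<in> vs2.span (g ` B)"
        using S(2) by (intro vs2.span_sum vs2.span_scale vs2.span_base) auto
      finally show "y \<in> vs2.span (g ` B)" .
    qed
    moreover have "g ` B \<subseteq> f ` W" using gQ BQ by auto
    ultimately have "card (g ` B) = vs2.dim (f ` W)"
      by (intro vs2.basis_card_eq_dim)
    then show ?thesis using gi by (simp add: card_image)
  qed
  \<comment> \<open>A finite quotient basis must also exist, since \<open>quotient_dim\<close> would
    otherwise return 0; the fibres over a basis of the image form one.\<close>
  obtain B2 where B2: "B2 \<subseteq> f ` W" "vs2.independent B2" "f ` W \<subseteq> vs2.span B2"
    using vs2.maximal_independent_subset by blast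
  have "finite B2" using vs2.independent_span_bound[OF Y(1) B2(2)] B2(1) Y(2) by blast
  define B where "B = C ` B2"
  have BQ: "B \<subseteq> Q" using B2 by (auto simp: B_def Q)
  have finB: "finite B" using \<open>finite B2\<close> by (simp add: B_def)
  have gB: "g ` B = B2" using gC B2(1) by (force simp: B_def image_image)
  have "vs1.quotient_basis W U B"
    unfolding vs1.quotient_basis_def
  proof (intro conjI allI impI ballI)
    show "B \<subseteq> quotient_space W U" using BQ Q_def by simp
  next
    fix S c X assume *: "finite S \<and> S \<subseteq> B \<and> vs1.quotient_comb U c S = U" and X: "X \<in> S"
    then have SQ: "S \<subseteq> Q" using BQ by blast
    have gi: "inj_on g S" using g_inj SQ inj_on_subset by blast
    have "(\<Sum>X\<in>S. s2 (c X) (g X)) = 0" using comb_0 SQ * by blast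
    then have "(\<Sum>v\<in>g ` S. s2 (c (the_inv_into S g v)) v) = 0"
      using gi by (simp add: sum.reindex the_inv_into_f_f)
    then have "c (the_inv_into S g (g X)) = 0"
      using vs2.independentD[OF B2(2), of "g ` S" "\<lambda>v. c (the_inv_into S g v)" "g X"] * X gB
      by auto
    then show "c X = 0" using gi X by (simp add: the_inv_into_f_f)
  next
    fix Y' assume "Y' \<in> quotient_space W U"
    then obtain y where y: "y \<in> f ` W" "Y' = C y" using Q Q_def by auto
    obtain c where "y = (\<Sum>v\<in>B2. s2 (c v) v)"
      using y(1) B2(3) vs2.span_finite[OF \<open>finite B2\<close>] by blast
    also have "\<dots> = (\<Sum>X\<in>B. s2 (c (g X)) (g X))"
      using g_inj BQ by (subst gB[symmetric], subst sum.reindex) (auto intro: inj_on_subset)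
    finally show "\<exists>S c. finite S \<and> S \<subseteq> B \<and> Y' = vs1.quotient_comb U c S"
      using comb[OF BQ finB, of "\<lambda>X. c (g X)"] y(2) finB by (intro exI[of _ B] exI[of _ "\<lambda>X. c (g X)"]) auto
  qed
  then have ex: "\<exists>B. finite B \<and> vs1.quotient_basis W U B" using finB by blast
  then show ?thesis
    unfolding vs1.quotient_dim_def using card_eq someI_ex[OF ex] by simp
qed

end

section \<open>Almost supermultiplicative sequences\<close>

text \<open>Fekete's lemma with superadditivity only above \<open>N\<close>. Division with remainder
  by a good \<open>k\<close> works as usual, but the remainder is taken in
  \<open>{k..<2 * k}\<close> so that every summand stays above \<open>N\<close>.\<close>

lemma superadditive_ratio_tendsto_Sup:
  fixes s :: "nat \<Rightarrow> real"
  assumes super: "\<And>m n. N < m \<Longrightarrow> N < n \<Longrightarrow> s m + s n \<le> s (m + n)"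
    and bound: "\<And>n. N < n \<Longrightarrow> s n \<le> M * real n"
  shows "(\<lambda>n. s n / real n) \<longlonglongrightarrow> (SUP n\<in>{N<..}. s n / real n)" (is "_ \<longlonglongrightarrow> ?u")
proof (rule LIMSEQ_I)
  have bdd: "bdd_above ((\<lambda>n. s n / real n) ` {N<..})"
    by (rule bdd_aboveI2[of _ _ M]) (use bound in \<open>auto simp: divide_le_eq\<close>)
  have upper: "s n / real n \<le> ?u" if "N < n" for n
    using that by (intro cSUP_upper bdd) auto
  fix e :: real assume e: "e > 0"
  obtain k where k: "N < k" "s k / real k > ?u - e / 2"
    using less_cSUP_iff[OF _ bdd, of "?u - e / 2"] e by auto
  have kpos: "k > 0" using k by simp
  define t where "t = s k / real k"
  \<comment> \<open>\<open>D\<close> bounds the loss \<open>r * t - s r\<close> over all possible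
    remainders, uniformly in \<open>n\<close>.\<close>
  define D where "D = Max ((\<lambda>r. \<bar>s r\<bar> + r * \<bar>t\<bar>) ` {k..<2 * k})"
  have mult: "real q * s k + s r \<le> s (q * k + r)" if "k \<le> r" for q r
  proof (induction q)
    case (Suc q)
    have "N < q * k + r" using that k by (simp add: trans_less_add2)
    then have "s k + s (q * k + r) \<le> s (k + (q * k + r))" using super k by blast
    then show ?case using Suc by (simp add: algebra_simps)
  qed simp
  have lower: "s n \<ge> real n * t - D" if "n \<ge> k" for n
  proof -
    define q where "q = (n - k) div k"
    define r where "r = k + (n - k) mod k"
    have n: "n = q * k + r" using that by (simp add: q_def r_def)
    have r: "r \<in> {k..<2 * k}" using kpos by (simp add: r_def)
    have "D \<ge> \<bar>s r\<bar> + real r * \<bar>t\<bar>"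
      unfolding D_def by (rule Max_ge) (use r in auto)
    moreover have "real n * t = real q * s k + real r * t"
      using kpos by (simp add: n t_def field_simps)
    moreover have "real r * t \<le> real r * \<bar>t\<bar>"
      by (intro mult_left_mono abs_ge_self) auto
    moreover have "real q * s k + s r \<le> s n" using mult r n by simp
    ultimately show ?thesis by linarith
  qed
  obtain n0 :: nat where n0: "real n0 > 2 * D / e" using reals_Archimedean2 by blast
  show "\<exists>no. \<forall>n\<ge>no. norm (s n / real n - ?u) < e"
  proof (intro exI allI impI)
    fix n assume n: "n \<ge> max n0 k"
    have npos: "real n > 0" using n kpos by simp
    have "2 * D / e < real n" using n0 n by linarith
    then have "D < e / 2 * real n" using e by (simp add: field_simps)
    then have "D / real n < e / 2" using npos by (simp add: field_simps)
    moreover have "s n / real n \<ge> t - D / real n"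
    proof -
      have "(real n * t - D) / real n \<le> s n / real n"
        using lower[of n] n npos by (intro divide_right_mono) auto
      then show ?thesis using npos by (simp add: diff_divide_distrib)
    qed
    ultimately show "norm (s n / real n - ?u) < e"
      using upper[of n] k n by (simp add: t_def)
  qed
qed

text \<open>Dividing by the constant before taking logarithms absorbs \<open>C\<close>, and shifting
  the index by \<open>K\<close> absorbs the gap; what remains is superadditive above
  \<open>K\<close>. Neither change affects the limit of the roots.\<close>

lemma convergent_root_supermultiplicative:
  fixes a :: "nat \<Rightarrow> nat"
  assumes pos: "\<And>n. n \<ge> 1 \<Longrightarrow> a n > 0"
    and super: "\<And>m n. m \<ge> 1 \<Longrightarrow> n \<ge> 1 \<Longrightarrow> a m * a n \<le> C * a (m + n + K)"
    and bound: "\<And>n. n \<ge> 1 \<Longrightarrow> a n \<le> D ^ (n + 1)"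
  shows "convergent (\<lambda>n. root n (real (a n)))"
proof -
  \<comment> \<open>The maxima with 1 make \<open>C'\<close> positive and \<open>ln D'\<close>
    nonnegative.\<close>
  define C' where "C' = real (max C 1)"
  define D' where "D' = real (max D 1)"
  define b where "b n = ln (real (a n) / C')" for n
  have C': "C' \<ge> 1" and D': "D' \<ge> 1" by (simp_all add: C'_def D'_def)
  have b_super: "b m + b n \<le> b (m + n + K)" if "m \<ge> 1" "n \<ge> 1" for m n
  proof -
    have "real (a m) * real (a n) \<le> real C * real (a (m + n + K))"
      using super[OF that] by (metis of_nat_le_iff of_nat_mult)
    also have "\<dots> \<le> C' * real (a (m + n + K))"
      by (intro mult_right_mono) (auto simp: C'_def)
    finally have "real (a m) / C' * (real (a n) / C') \<le> real (a (m + n + K)) / C'"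
      using C' by (simp add: field_simps)
    moreover have "b m + b n = ln (real (a m) / C' * (real (a n) / C'))"
      unfolding b_def using pos[OF that(1)] pos[OF that(2)] C' by (subst ln_mult) auto
    ultimately show ?thesis
      unfolding b_def using pos[of m] pos[of n] pos[of "m + n + K"] that C' by (simp add: ln_le_cancel_iff)
  qed
  have b_bound: "b n \<le> 2 * ln D' * real n" if "n \<ge> 1" for n
  proof -
    have "real (a n) \<le> real D ^ (n + 1)" using bound[OF that] by (metis of_nat_le_iff of_nat_power)
    also have "\<dots> \<le> D' ^ (n + 1)" by (intro power_mono) (auto simp: D'_def)
    finally have "real (a n) \<le> D' ^ (n + 1)" .
    moreover have "real (a n) / C' \<le> real (a n)" using C' by (simp add: divide_le_eq mult_le_cancel_left1)
    ultimately have "b n \<le> ln (D' ^ (n + 1))"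
      unfolding b_def using pos[OF that] C' D' by (subst ln_le_cancel_iff) auto
    also have "\<dots> = (real n + 1) * ln D'" using D' by (subst ln_realpow) auto
    also have "\<dots> \<le> (2 * real n) * ln D'" using that D' by (intro mult_right_mono) auto
    finally show ?thesis by (simp add: mult_ac)
  qed
  \<comment> \<open>The indices satisfy \<open>(m - K) + (n - K) + K = m + n - K\<close>, so
    \<open>s\<close> is superadditive; for \<open>n > K\<close> the shifted index is at least 1,
    where \<open>a\<close> is positive.\<close>
  define s where "s n = b (n - K)" for n
  have "(\<lambda>n. s n / real n) \<longlonglongrightarrow> (SUP n\<in>{K<..}. s n / real n)"
  proof (rule superadditive_ratio_tendsto_Sup)
    fix m n assume "K < m" "K < n"
    moreover from this have "m - K + (n - K) + K = m + n - K" by simp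
    ultimately show "s m + s n \<le> s (m + n)"
      using b_super[of "m - K" "n - K"] by (simp add: s_def)
  next
    fix n assume n: "K < n"
    have "s n \<le> 2 * ln D' * real (n - K)" using b_bound[of "n - K"] n by (simp add: s_def)
    also have "\<dots> \<le> 2 * ln D' * real n" using D' by (intro mult_left_mono) auto
    finally show "s n \<le> 2 * ln D' * real n" .
  qed
  then obtain u where "(\<lambda>n. s n / real n) \<longlonglongrightarrow> u" by blast
  then have "(\<lambda>n. s (n + K) / real (n + K)) \<longlonglongrightarrow> u" by (rule LIMSEQ_ignore_initial_segment)
  then have "(\<lambda>n. b n / real (n + K)) \<longlonglongrightarrow> u" by (simp add: s_def)
  \<comment> \<open>The shift by \<open>K\<close> and the division by \<open>C'\<close> are undone:
    the first contributes a factor tending to 1, the second a summand tending to 0.\<close>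
  moreover have "(\<lambda>n. real (n + K) / real n) \<longlonglongrightarrow> 1" by real_asymp
  ultimately have "(\<lambda>n. b n / real (n + K) * (real (n + K) / real n)) \<longlonglongrightarrow> u * 1"
    by (rule tendsto_mult)
  moreover have "(\<lambda>n. ln C' / real n) \<longlonglongrightarrow> 0" by real_asymp
  ultimately have "(\<lambda>n. exp (b n / real (n + K) * (real (n + K) / real n) + ln C' / real n)) \<longlonglongrightarrow> exp (u * 1 + 0)"
    by (intro tendsto_exp tendsto_add)
  moreover have "\<forall>\<^sub>F n in sequentially.
      exp (b n / real (n + K) * (real (n + K) / real n) + ln C' / real n) = root n (real (a n))"
    using eventually_ge_at_top[of 1]
  proof eventually_elim
    case (elim n)
    have "b n / real (n + K) * (real (n + K) / real n) = b n / real n" using elim by simp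
    moreover have "b n + ln C' = ln (real (a n))"
      unfolding b_def using pos[OF elim] C' by (simp add: ln_div)
    ultimately have "b n / real (n + K) * (real (n + K) / real n) + ln C' / real n = ln (real (a n)) / real n"
      by (simp add: add_divide_distrib[symmetric])
    also have "exp \<dots> = root n (real (a n))"
      using pos[OF elim] elim by (simp add: root_powr_inverse powr_def)
    finally show ?case .
  qed
  ultimately show ?thesis
    by (intro convergentI) (rule Lim_transform_eventually)
qed

section \<open>Graded algebras and their homogeneous components\<close>

lemma letters_map_monomial: "letters (map_monomial f m) = map f (letters m)"
  by (induction m) auto

lemma eval_map_monomial: "eval_monomial mul \<rho> (map_monomial f m) = eval_monomial mul (\<rho> \<circ> f) m"
  by (induction m) auto

lemma eval_monomial_cong:
  "(\<And>v. v \<in> set (letters m) \<Longrightarrow> \<rho> v = \<rho>' v) \<Longrightarrow> eval_monomial mul \<rho> m = eval_monomial mul \<rho>' m"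
  by (induction m) auto

context nonassoc_algebra
begin

lemma linear_mult_left: "Vector_Spaces.linear scale scale (\<lambda>a. mult a b)"
  unfolding Vector_Spaces.linear_iff
  by (simp add: mult_add_left mult_scale_left vector_space_axioms)

lemma linear_mult_right: "Vector_Spaces.linear scale scale (\<lambda>b. mult a b)"
  unfolding Vector_Spaces.linear_iff
  by (simp add: mult_add_right mult_scale_right vector_space_axioms)

lemma mult_zero_left [simp]: "mult 0 b = 0"
  using mult_scale_left[of 0 0 b] by simp

lemma mult_zero_right [simp]: "mult a 0 = 0"
  using mult_scale_right[of a 0 0] by simp

text \<open>By bilinearity, membership extends from spanning sets to all elements, one argument at a
  time.\<close>

lemma mult_in_subspace:
  assumes X: "span X = UNIV" and Y: "span Y = UNIV" and S: "subspace S"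
    and XY: "\<And>x y. x \<in> X \<Longrightarrow> y \<in> Y \<Longrightarrow> mult x y \<in> S"
  shows "mult x y \<in> S"
proof -
  have 1: "mult x y \<in> S" if x: "x \<in> X" for x y
  proof -
    interpret l: Vector_Spaces.linear scale scale "\<lambda>y. mult x y" by (rule linear_mult_right)
    have "span Y \<subseteq> {y. mult x y \<in> S}"
      by (rule span_minimal) (use XY x l.subspace_linear_preimage[OF S] in auto)
    then show ?thesis using Y by auto
  qed
  interpret l: Vector_Spaces.linear scale scale "\<lambda>x. mult x y" by (rule linear_mult_left)
  have "span X \<subseteq> {x. mult x y \<in> S}"
    by (rule span_minimal) (use 1 l.subspace_linear_preimage[OF S] in auto)
  then show ?thesis using X by auto
qed

end

context graded_algebra
begin

definition decomposition :: "'a \<Rightarrow> ('t \<Rightarrow> 'a) \<Rightarrow> bool" where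
  "decomposition a g \<longleftrightarrow> (\<forall>t\<in>T. g t \<in> A t) \<and> (\<forall>t. t \<notin> T \<longrightarrow> g t = 0) \<and>
     finite {t. g t \<noteq> 0} \<and> a = (\<Sum>t | g t \<noteq> 0. g t)"

definition proj :: "'t \<Rightarrow> 'a \<Rightarrow> 'a" where
  "proj t a = (THE g. decomposition a g) t"

lemma ex1_decomposition: "\<exists>!g. decomposition a g"
  using direct_sum_components unfolding direct_sum_def decomposition_def by blast

lemma decomposition_proj: "decomposition a (\<lambda>t. proj t a)"
  unfolding proj_def using theI'[OF ex1_decomposition[of a]] by simp

lemma proj_eqI: "decomposition a g \<Longrightarrow> proj t a = g t"
  unfolding proj_def using the1_equality[OF ex1_decomposition] by metis

lemma subspace_component: "t \<in> T \<Longrightarrow> subspace (A t)"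
  using direct_sum_components unfolding direct_sum_def by blast

lemma proj_in: "t \<in> T \<Longrightarrow> proj t a \<in> A t"
  and proj_outside: "t \<notin> T \<Longrightarrow> proj t a = 0"
  and finite_proj: "finite {t. proj t a \<noteq> 0}"
  and sum_proj: "(\<Sum>t | proj t a \<noteq> 0. proj t a) = a"
  using decomposition_proj[of a] unfolding decomposition_def by metis+

lemma decompositionI:
  assumes "\<And>t. t \<in> T \<Longrightarrow> g t \<in> A t" "\<And>t. t \<notin> T \<Longrightarrow> g t = 0"
    and S: "finite S" "\<And>t. t \<notin> S \<Longrightarrow> g t = 0" "a = sum g S"
  shows "decomposition a g"
proof -
  have sub: "{t. g t \<noteq> 0} \<subseteq> S" using S by blast
  then have "sum g S = (\<Sum>t | g t \<noteq> 0. g t)"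
    by (intro sum.mono_neutral_right) (use S in auto)
  then show ?thesis using assms sub finite_subset unfolding decomposition_def by blast
qed

lemma sum_proj_superset:
  assumes "finite S" "{t. proj t a \<noteq> 0} \<subseteq> S"
  shows "(\<Sum>t\<in>S. proj t a) = a"
proof -
  have "(\<Sum>t\<in>S. proj t a) = (\<Sum>t | proj t a \<noteq> 0. proj t a)"
    by (intro sum.mono_neutral_right) (use assms in auto)
  then show ?thesis by (simp only: sum_proj)
qed

lemma linear_proj: "Vector_Spaces.linear scale scale (proj t)"
  unfolding Vector_Spaces.linear_iff
proof (intro conjI allI vector_space_axioms)
  fix a b c
  have "decomposition (a + b) (\<lambda>t. proj t a + proj t b)"
    by (rule decompositionI[where S = "{t. proj t a \<noteq> 0} \<union> {t. proj t b \<noteq> 0}"])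
      (auto simp: finite_proj sum.distrib sum_proj_superset proj_outside
        intro: subspace_add[OF subspace_component] proj_in)
  then show "proj t (a + b) = proj t a + proj t b" by (rule proj_eqI)
  have "decomposition (scale c a) (\<lambda>t. scale c (proj t a))"
    by (rule decompositionI[where S = "{t. proj t a \<noteq> 0}"])
      (auto simp: finite_proj sum_proj scale_sum_right[symmetric] proj_outside
        intro: subspace_scale[OF subspace_component] proj_in)
  then show "proj t (scale c a) = scale c (proj t a)" by (rule proj_eqI)
qed

lemma proj_zero [simp]: "proj t 0 = 0"
  by (rule proj_eqI, rule decompositionI[where S = "{}"])
    (auto intro: subspace_0[OF subspace_component])

lemma proj_component:
  assumes "a \<in> A t" "t \<in> T"
  shows "proj s a = (if s = t then a else 0)"
  by (rule proj_eqI, rule decompositionI[where S = "{t}"])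
    (use assms subspace_0[OF subspace_component] in auto)

definition homogeneous :: "'a set" where
  "homogeneous = (\<Union>t\<in>T. A t)"

lemma proj_homogeneous: "t \<in> T \<Longrightarrow> proj t a \<in> homogeneous"
  unfolding homogeneous_def using proj_in by blast

lemma mult_homogeneous: "a \<in> homogeneous \<Longrightarrow> b \<in> homogeneous \<Longrightarrow> mult a b \<in> homogeneous"
  unfolding homogeneous_def using mult_components by blast

lemma span_homogeneous: "span homogeneous = UNIV"
proof -
  have "a \<in> span homogeneous" for a
  proof -
    have "(\<Sum>t | proj t a \<noteq> 0. proj t a) \<in> span homogeneous"
      using proj_homogeneous proj_outside by (intro span_sum span_base) blast
    then show ?thesis by (simp add: sum_proj)
  qed
  then show ?thesis by blast
qed

text \<open>Absorption extends from homogeneous factors and generators by bilinearity. The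
  projections send each homogeneous generator to itself or to 0, so \<open>span S\<close> contains
  the components of its elements.\<close>

lemma graded_ideal_span:
  assumes S: "S \<subseteq> homogeneous"
    and ideal: "\<And>x z. x \<in> S \<Longrightarrow> z \<in> homogeneous \<Longrightarrow> mult x z \<in> span S \<and> mult z x \<in> span S"
  shows "graded_ideal (span S)"
  unfolding graded_ideal_def direct_sum_def
proof (intro conjI allI ballI subspace_span)
  fix a x assume x: "x \<in> span S"
  have *: "mult x a \<in> span S \<and> mult a x \<in> span S" if x: "x \<in> S" for x a
  proof -
    interpret l: Vector_Spaces.linear scale scale "\<lambda>y. mult x y" by (rule linear_mult_right)
    interpret r: Vector_Spaces.linear scale scale "\<lambda>y. mult y x" by (rule linear_mult_left)
    have "span homogeneous \<subseteq> {y. mult x y \<in> span S} \<inter> {y. mult y x \<in> span S}"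
      by (rule span_minimal)
        (use ideal x l.subspace_linear_preimage r.subspace_linear_preimage in \<open>auto intro!: subspace_inter\<close>)
    then show ?thesis using span_homogeneous by auto
  qed
  interpret l: Vector_Spaces.linear scale scale "\<lambda>y. mult a y" by (rule linear_mult_right)
  interpret r: Vector_Spaces.linear scale scale "\<lambda>y. mult y a" by (rule linear_mult_left)
  have "span S \<subseteq> {y. mult a y \<in> span S} \<inter> {y. mult y a \<in> span S}"
    by (rule span_minimal)
      (use * l.subspace_linear_preimage r.subspace_linear_preimage in \<open>auto intro!: subspace_inter\<close>)
  then show "mult a x \<in> span S" "mult x a \<in> span S" using x by auto
next
  fix t assume "t \<in> T"
  then show "subspace (span S \<inter> A t)" by (intro subspace_inter subspace_component subspace_span)
next
  fix t show "span S \<inter> A t \<subseteq> span S" by blast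
next
  fix w assume w: "w \<in> span S"
  have proj: "proj t w \<in> span S" for t
  proof -
    interpret l: Vector_Spaces.linear scale scale "proj t" by (rule linear_proj)
    have "span S \<subseteq> {w. proj t w \<in> span S}"
    proof (rule span_minimal)
      show "S \<subseteq> {w. proj t w \<in> span S}"
        using S proj_component span_base span_zero unfolding homogeneous_def by force
    qed (rule l.subspace_linear_preimage, rule subspace_span)
    then show ?thesis using w by auto
  qed
  show "\<exists>!g. (\<forall>t\<in>T. g t \<in> span S \<inter> A t) \<and> (\<forall>t. t \<notin> T \<longrightarrow> g t = 0) \<and>
      finite {t. g t \<noteq> 0} \<and> w = (\<Sum>t | g t \<noteq> 0. g t)"
  proof (rule ex1I[of _ "\<lambda>t. proj t w"])
    show "(\<forall>t\<in>T. proj t w \<in> span S \<inter> A t) \<and> (\<forall>t. t \<notin> T \<longrightarrow> proj t w = 0) \<and>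
        finite {t. proj t w \<noteq> 0} \<and> w = (\<Sum>t | proj t w \<noteq> 0. proj t w)"
      using proj decomposition_proj[of w] unfolding decomposition_def by auto
  next
    fix g assume "(\<forall>t\<in>T. g t \<in> span S \<inter> A t) \<and> (\<forall>t. t \<notin> T \<longrightarrow> g t = 0) \<and>
      finite {t. g t \<noteq> 0} \<and> w = (\<Sum>t | g t \<noteq> 0. g t)"
    then have "decomposition w g" unfolding decomposition_def by blast
    then show "g = (\<lambda>t. proj t w)" using proj_eqI by fastforce
  qed
qed

end

section \<open>Multilinear polynomial functions\<close>

locale fd_graded_algebra =
  graded_algebra scale mult T A + finite_dimensional_vector_space scale Basis
  for scale :: "'f::field \<Rightarrow> 'a::ab_group_add \<Rightarrow> 'a" and mult :: "'a \<Rightarrow> 'a \<Rightarrow> 'a"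
    and T :: "'t set" and A :: "'t \<Rightarrow> 'a set" and Basis :: "'a set"
begin

definition fscale :: "'f \<Rightarrow> ((nat \<Rightarrow> 'a) \<Rightarrow> 'a) \<Rightarrow> (nat \<Rightarrow> 'a) \<Rightarrow> 'a" where
  "fscale c F = (\<lambda>\<phi>. scale c (F \<phi>))"

lemma fscale_apply [simp]: "fscale c F \<phi> = scale c (F \<phi>)"
  by (simp add: fscale_def)

sublocale fs: vector_space fscale
  by unfold_locales (auto simp: fun_eq_iff scale_right_distrib scale_left_distrib)

sublocale fpair: vector_space_pair fscale scale ..

lemma linear_eval_at: "Vector_Spaces.linear fscale scale (\<lambda>F. F \<phi>)"
  unfolding Vector_Spaces.linear_iff by (simp add: vector_space_axioms fs.vector_space_axioms)

text \<open>These are the degrees with a nonzero component. They are finite in number even for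
  infinite \<open>T\<close>, because each basis vector has finite support.\<close>

definition supp :: "'t set" where
  "supp = (\<Union>b\<in>Basis. {t. proj t b \<noteq> 0})"

lemma finite_supp: "finite supp"
  unfolding supp_def by (auto simp: finite_Basis finite_proj)

lemma proj_not_supp: "t \<notin> supp \<Longrightarrow> proj t a = 0"
proof -
  assume t: "t \<notin> supp"
  interpret l: Vector_Spaces.linear scale scale "proj t" by (rule linear_proj)
  show ?thesis using l.eq_0_on_span[of Basis a] t span_Basis unfolding supp_def by blast
qed

lemma supp_subset: "supp \<subseteq> T"
  unfolding supp_def using proj_outside by blast

lemma sum_proj_supp: "(\<Sum>t\<in>supp. proj t a) = a"
  by (rule sum_proj_superset[OF finite_supp]) (use proj_not_supp in blast)

text \<open>One arbitrary element of the algebra per index supplies all variables with that index,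
  through its components. Graded substitutions thereby become ungraded arguments, in which
  multilinear monomials are multilinear functions.\<close>

definition subst :: "(nat \<Rightarrow> 'a) \<Rightarrow> 't \<times> nat \<Rightarrow> 'a" where
  "subst \<phi> = (\<lambda>(t, i). proj t (\<phi> i))"

definition ev :: "('t \<times> nat) monomial \<Rightarrow> (nat \<Rightarrow> 'a) \<Rightarrow> 'a" where
  "ev m \<phi> = eval_monomial mult (subst \<phi>) m"

lemma ev_simps [simp]:
  "ev (Var (t, i)) \<phi> = proj t (\<phi> i)" "ev (Prod p q) \<phi> = mult (ev p \<phi>) (ev q \<phi>)"
  by (simp_all add: ev_def subst_def)

text \<open>As in the definition of $W_n$, every index occurs exactly once in a monomial, whatever the
  degrees of its variables.\<close>

definition index_monomials :: "nat set \<Rightarrow> ('t \<times> nat) monomial set" where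
  "index_monomials J = {m. distinct (map snd (letters m)) \<and> snd ` set (letters m) = J \<and>
     fst ` set (letters m) \<subseteq> T}"

text \<open>For \<open>J = {1..n}\<close> this is the space $V_n$ of the introduction. Other index
  sets occur when functions in disjoint variables are combined.\<close>

definition polyfuns :: "nat set \<Rightarrow> ((nat \<Rightarrow> 'a) \<Rightarrow> 'a) set" where
  "polyfuns J = fs.span (ev ` index_monomials J)"

lemma subspace_polyfuns: "fs.subspace (polyfuns J)"
  unfolding polyfuns_def by (rule fs.subspace_span)

lemma polyfuns_ev: "m \<in> index_monomials J \<Longrightarrow> ev m \<in> polyfuns J"
  unfolding polyfuns_def by (intro fs.span_base imageI)

lemma polyfuns_induct [consumes 1, case_names subspace ev]:
  assumes "F \<in> polyfuns J" "fs.subspace {F. P F}" "\<And>m. m \<in> index_monomials J \<Longrightarrow> P (ev m)"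
  shows "P F"
  using fs.span_minimal[of "ev ` index_monomials J" "{F. P F}"] assms unfolding polyfuns_def by auto

lemma ev_cong:
  "(\<And>j. j \<in> snd ` set (letters m) \<Longrightarrow> \<phi> j = \<psi> j) \<Longrightarrow> ev m \<phi> = ev m \<psi>"
  unfolding ev_def by (rule eval_monomial_cong) (force simp: subst_def)

lemma polyfuns_cong:
  assumes "F \<in> polyfuns J" "\<And>j. j \<in> J \<Longrightarrow> \<phi> j = \<psi> j"
  shows "F \<phi> = F \<psi>"
  using assms(1)
proof (induction rule: polyfuns_induct)
  case subspace
  show ?case by (auto simp: fs.subspace_def)
next
  case (ev m)
  then show ?case using assms(2) by (intro ev_cong) (auto simp: index_monomials_def)
qed

text \<open>The index \<open>j\<close> occurs only once, hence in exactly one factor of each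
  product; the other factor is constant in \<open>x\<close>.\<close>

lemma linear_ev:
  assumes "distinct (map snd (letters m))" "j \<in> snd ` set (letters m)"
  shows "Vector_Spaces.linear scale scale (\<lambda>x. ev m (\<phi>(j := x)))"
  using assms
proof (induction m)
  case (Var v)
  then show ?case using linear_proj[of "fst v"] by (cases v) auto
next
  case (Prod p q)
  then consider "j \<in> snd ` set (letters p)" "j \<notin> snd ` set (letters q)"
    | "j \<in> snd ` set (letters q)" "j \<notin> snd ` set (letters p)"
    by auto
  then show ?case
  proof cases
    case 1
    have "ev q (\<phi>(j := x)) = ev q \<phi>" for x using 1 by (intro ev_cong) (metis fun_upd_other)
    moreover have "Vector_Spaces.linear scale scale (\<lambda>x. ev p (\<phi>(j := x)))"
      by (rule Prod.IH(1)) (use Prod.prems 1 in auto)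
    ultimately show ?thesis
      unfolding ev_simps Vector_Spaces.linear_iff by (metis mult_add_left mult_scale_left)
  next
    case 2
    have "ev p (\<phi>(j := x)) = ev p \<phi>" for x using 2 by (intro ev_cong) (metis fun_upd_other)
    moreover have "Vector_Spaces.linear scale scale (\<lambda>x. ev q (\<phi>(j := x)))"
      by (rule Prod.IH(2)) (use Prod.prems 2 in auto)
    ultimately show ?thesis
      unfolding ev_simps Vector_Spaces.linear_iff by (metis mult_add_right mult_scale_right)
  qed
qed

lemma linear_polyfuns:
  assumes "F \<in> polyfuns J" "j \<in> J"
  shows "Vector_Spaces.linear scale scale (\<lambda>x. F (\<phi>(j := x)))"
  using assms(1)
proof (induction rule: polyfuns_induct)
  case subspace
  show ?case
    by (auto simp: fs.subspace_def Vector_Spaces.linear_iff vector_space_axioms algebra_simps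
        scale_left_commute)
next
  case (ev m)
  then show ?case using assms(2) by (intro linear_ev) (auto simp: index_monomials_def)
qed

lemma polyfuns_zero:
  assumes "F \<in> polyfuns J" "j \<in> J" "\<phi> j = 0"
  shows "F \<phi> = 0"
proof -
  interpret l: Vector_Spaces.linear scale scale "\<lambda>x. F (\<phi>(j := x))"
    using assms by (intro linear_polyfuns)
  have "\<phi>(j := 0) = \<phi>" using assms(3) by auto
  then show ?thesis using l.zero by argo
qed

text \<open>A multilinear function is determined by its values on a spanning set. In the induction,
  \<open>I\<close> is the set of indices whose arguments have been freed from
  \<open>X\<close>.\<close>

lemma polyfuns_eq_0_spanning:
  assumes F: "F \<in> polyfuns J" and J: "finite J" and X: "span X = UNIV"
    and 0: "\<And>\<phi>. (\<And>j. j \<in> J \<Longrightarrow> \<phi> j \<in> X) \<Longrightarrow> F \<phi> = 0"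
  shows "F \<phi> = 0"
proof -
  have "F \<phi> = 0" if "finite I" "I \<subseteq> J" "\<And>j. j \<in> J - I \<Longrightarrow> \<phi> j \<in> X" for I \<phi>
    using that
  proof (induction I arbitrary: \<phi> rule: finite_induct)
    case empty
    then show ?case using 0 by auto
  next
    case (insert i I)
    interpret l: Vector_Spaces.linear scale scale "\<lambda>x. F (\<phi>(i := x))"
      using F insert.prems by (intro linear_polyfuns) auto
    have "F (\<phi>(i := x)) = 0" if "x \<in> X" for x
      using insert.prems that by (intro insert.IH) auto
    then have "F (\<phi>(i := \<phi> i)) = 0"
      using l.eq_0_on_span[of X] X by blast
    then show ?case by simp
  qed
  from this[OF J] show ?thesis by auto
qed

text \<open>Renaming the indices of a monomial amounts to composing the assignment with
  \<open>h\<close>, and injectivity keeps the indices distinct. This moves the variables of a second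
  function away from those of a first.\<close>

lemma polyfuns_map_indices:
  assumes F: "F \<in> polyfuns J" and h: "inj_on h J"
  shows "(\<lambda>\<phi>. F (\<phi> \<circ> h)) \<in> polyfuns (h ` J)"
  using F
proof (induction rule: polyfuns_induct)
  case subspace
  show ?case
    using fs.subspace_0[OF subspace_polyfuns] fs.subspace_add[OF subspace_polyfuns]
      fs.subspace_scale[OF subspace_polyfuns]
    by (auto simp: fs.subspace_def plus_fun_def zero_fun_def fscale_def)
next
  case (ev m)
  define f where "f = (\<lambda>(t :: 't, i). (t, h i))"
  have f: "fst (f v) = fst v" "snd (f v) = h (snd v)" for v by (auto simp: f_def split: prod.splits)
  have "distinct (map h (map snd (letters m)))"
    using ev h by (auto simp: index_monomials_def distinct_map simp del: map_map)
  then have "distinct (map snd (letters (map_monomial f m)))"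
    by (simp add: letters_map_monomial f o_def)
  moreover have "snd ` set (letters (map_monomial f m)) = h ` J"
    using ev by (auto simp: index_monomials_def letters_map_monomial f image_image)
  moreover have "fst ` set (letters (map_monomial f m)) \<subseteq> T"
    using ev by (auto simp: index_monomials_def letters_map_monomial f image_image)
  ultimately have "map_monomial f m \<in> index_monomials (h ` J)"
    by (simp add: index_monomials_def)
  then have "ev (map_monomial f m) \<in> polyfuns (h ` J)" by (rule polyfuns_ev)
  moreover have "ev (map_monomial f m) = (\<lambda>\<phi>. ev m (\<phi> \<circ> h))"
    unfolding ev_def eval_map_monomial
    by (rule ext, rule eval_monomial_cong) (auto simp: subst_def f_def)
  ultimately show ?case by argo
qed

lemma polyfuns_mult:
  assumes F: "F \<in> polyfuns I" and G: "G \<in> polyfuns J" and IJ: "I \<inter> J = {}"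
  shows "(\<lambda>\<phi>. mult (F \<phi>) (G \<phi>)) \<in> polyfuns (I \<union> J)"
  using F
proof (induction rule: polyfuns_induct)
  case subspace
  show ?case
    using fs.subspace_0[OF subspace_polyfuns] fs.subspace_add[OF subspace_polyfuns]
      fs.subspace_scale[OF subspace_polyfuns]
    by (auto simp: fs.subspace_def plus_fun_def zero_fun_def fscale_def mult_add_left mult_scale_left)
next
  case (ev p)
  show ?case using G
  proof (induction rule: polyfuns_induct)
    case subspace
    show ?case
      using fs.subspace_0[OF subspace_polyfuns] fs.subspace_add[OF subspace_polyfuns]
        fs.subspace_scale[OF subspace_polyfuns]
      by (auto simp: fs.subspace_def plus_fun_def zero_fun_def fscale_def mult_add_right mult_scale_right)
  next
    case (ev q)
    have "Prod p q \<in> index_monomials (I \<union> J)"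
      using \<open>p \<in> index_monomials I\<close> ev IJ by (auto simp: index_monomials_def image_Un)
    then have "ev (Prod p q) \<in> polyfuns (I \<union> J)" by (rule polyfuns_ev)
    moreover have "ev (Prod p q) = (\<lambda>\<phi>. mult (ev p \<phi>) (ev q \<phi>))" by (rule ext) simp
    ultimately show ?case by simp
  qed
qed

text \<open>An argument is the sum of its components, and only the finitely many degrees in
  \<open>supp\<close> contribute, so the function is a finite sum of graded variables.\<close>

lemma polyfuns_variable: "(\<lambda>\<phi>. \<phi> j) \<in> polyfuns {j}"
proof -
  have *: "(\<lambda>\<phi>. \<Sum>t\<in>S. proj t (\<phi> j)) \<in> polyfuns {j}" if "finite S" "S \<subseteq> T" for S
    using that
  proof (induction S rule: finite_induct)
    case empty
    then show ?case using fs.subspace_0[OF subspace_polyfuns] by (simp add: zero_fun_def)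
  next
    case (insert t S)
    have "ev (Var (t, j)) \<in> polyfuns {j}"
      using insert.prems by (intro polyfuns_ev) (auto simp: index_monomials_def)
    moreover have "ev (Var (t, j)) = (\<lambda>\<phi>. proj t (\<phi> j))" by (rule ext) simp
    ultimately show ?case
      using fs.subspace_add[OF subspace_polyfuns] insert by (simp add: plus_fun_def)
  qed
  show ?thesis using *[OF finite_supp supp_subset] by (simp add: sum_proj_supp)
qed

text \<open>The product of two components lies in a single component, so by induction the monomial
  alone fixes a degree common to all its values.\<close>

lemma ev_component:
  assumes "fst ` set (letters m) \<subseteq> T"
  obtains r where "r \<in> T" "\<And>\<phi>. ev m \<phi> \<in> A r"
proof -
  have "\<exists>r\<in>T. \<forall>\<phi>. ev m \<phi> \<in> A r"
    using assms
  proof (induction m)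
    case (Var v)
    then show ?case by (cases v) (auto intro!: bexI[of _ "fst v"] proj_in)
  next
    case (Prod p q)
    then obtain r s where "r \<in> T" "s \<in> T" "\<forall>\<phi>. ev p \<phi> \<in> A r" "\<forall>\<phi>. ev q \<phi> \<in> A s"
      by (auto simp: image_Un)
    then show ?case using mult_components[of r s] by fastforce
  qed
  then show thesis using that by blast
qed

lemma ev_zero: "v \<in> set (letters m) \<Longrightarrow> subst \<phi> v = 0 \<Longrightarrow> ev m \<phi> = 0"
  by (induction m) (auto simp: ev_def)

text \<open>On the function of a monomial this acts as the identity or as zero: a monomial prescribes
  the degrees of its variables, and by the grading all its values have the same degree.\<close>

lemma polyfuns_component:
  assumes F: "F \<in> polyfuns J" and \<tau>: "\<And>j. j \<in> J \<Longrightarrow> \<tau> j \<in> T"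
  shows "(\<lambda>\<phi>. proj r (F (\<lambda>j. proj (\<tau> j) (\<phi> j)))) \<in> polyfuns J"
proof -
  interpret l: Vector_Spaces.linear scale scale "proj r" by (rule linear_proj)
  show ?thesis using F
  proof (induction rule: polyfuns_induct)
    case subspace
    show ?case
      using fs.subspace_0[OF subspace_polyfuns] fs.subspace_add[OF subspace_polyfuns]
        fs.subspace_scale[OF subspace_polyfuns]
      by (auto simp: fs.subspace_def plus_fun_def zero_fun_def fscale_def l.add l.scale)
  next
    case (ev m)
    then have m: "snd ` set (letters m) = J" "fst ` set (letters m) \<subseteq> T"
      by (auto simp: index_monomials_def)
    define f where "f = (\<lambda>\<phi>. proj r (ev m (\<lambda>j. proj (\<tau> j) (\<phi> j))))"
    obtain s where s: "s \<in> T" "\<And>\<phi>. ev m \<phi> \<in> A s" using ev_component[OF m(2)] by blast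
    have "f = ev m \<or> f = 0"
    proof (cases "r = s \<and> (\<forall>(t, i)\<in>set (letters m). t = \<tau> i)")
      case True
      have "ev m (\<lambda>j. proj (\<tau> j) (\<phi> j)) = ev m \<phi>" for \<phi>
        unfolding ev_def
      proof (rule eval_monomial_cong)
        fix v assume v: "v \<in> set (letters m)"
        obtain t i where ti: "v = (t, i)" by (cases v)
        have "t = \<tau> i" "t \<in> T" using True v ti m(2) by (auto simp: image_subset_iff)
        then show "subst (\<lambda>j. proj (\<tau> j) (\<phi> j)) v = subst \<phi> v"
          using proj_component[OF proj_in, of t t] by (simp add: subst_def ti)
      qed
      then show ?thesis using proj_component[OF s(2,1), of r] True by (auto simp: f_def fun_eq_iff)
    next
      case False
      have "f \<phi> = 0" for \<phi>
      proof (cases "r = s")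
        case True
        with False obtain t i where ti: "(t, i) \<in> set (letters m)" "t \<noteq> \<tau> i" by auto
        then have "i \<in> J" using m(1) by force
        then have "proj t (proj (\<tau> i) (\<phi> i)) = 0"
          using proj_component[OF proj_in[OF \<tau>] \<tau>, of i t] ti by simp
        then show ?thesis
          using ev_zero[OF ti(1), of "\<lambda>j. proj (\<tau> j) (\<phi> j)"] by (simp add: f_def subst_def)
      next
        case False
        then show ?thesis using proj_component[OF s(2,1), of r] by (simp add: f_def)
      qed
      then show ?thesis by (auto simp: fun_eq_iff)
    qed
    then show ?case
      using polyfuns_ev[OF ev] fs.subspace_0[OF subspace_polyfuns] unfolding f_def by auto
  qed
qed

end

section \<open>Dimension bounds for spaces of multilinear functions\<close>

context fd_graded_algebra
begin

text \<open>A multilinear function is determined by its values at the tuples of basis vectors. There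
  are \<open>card Basis ^ card J\<close> such tuples, each imposing at most
  \<open>card Basis\<close> linear conditions.\<close>

lemma card_independent_polyfuns_le:
  assumes S: "finite S" "fs.independent S" "S \<subseteq> polyfuns J" and J: "finite J"
  shows "card S \<le> card Basis ^ card J * card Basis"
proof -
  define P where "P = J \<rightarrow>\<^sub>E Basis"
  have P: "finite P" "card P = card Basis ^ card J"
    using J by (simp_all add: P_def finite_PiE finite_Basis card_PiE)
  obtain S' where S': "finite S'" "fs.independent S'" "S' \<subseteq> fs.span S"
    "\<forall>F\<in>S'. \<forall>\<phi>\<in>P. F \<phi> = 0" "card S \<le> card S' + card P * card Basis"
    by (rule fpair.independent_kernels[where f = "\<lambda>\<phi> F. F \<phi>",
          OF linear_eval_at P(1) S(1,2) finite_Basis span_Basis])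
  have "S' = {}"
  proof (rule ccontr)
    assume "S' \<noteq> {}"
    then obtain F where F: "F \<in> S'" by blast
    then have FJ: "F \<in> polyfuns J"
      using S'(3) S(3) fs.span_minimal[OF _ subspace_polyfuns] by blast
    have "F \<phi> = 0" for \<phi>
    proof (rule polyfuns_eq_0_spanning[OF FJ J span_Basis])
      fix \<phi> assume "\<And>j. j \<in> J \<Longrightarrow> \<phi> j \<in> Basis"
      then have "F (restrict \<phi> J) = 0" using S'(4) F by (auto simp: P_def)
      then show "F \<phi> = 0" using polyfuns_cong[OF FJ, of \<phi> "restrict \<phi> J"] by simp
    qed
    then have "F = 0" by (simp add: fun_eq_iff)
    then show False using F S'(2) fs.dependent_zero by blast
  qed
  then show ?thesis using S'(5) P by simp
qed

text \<open>The ambient space of all functions may be infinite dimensional, so finiteness of the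
  basis comes from the uniform bound on independent sets.\<close>

lemma polyfuns_basis:
  assumes J: "finite J"
  obtains B where "finite B" "fs.independent B" "B \<subseteq> polyfuns J" "polyfuns J \<subseteq> fs.span B"
    "card B = fs.dim (polyfuns J)"
proof -
  obtain B where B: "B \<subseteq> polyfuns J" "fs.independent B" "polyfuns J \<subseteq> fs.span B"
    "card B = fs.dim (polyfuns J)"
    using fs.basis_exists[of "polyfuns J"] by blast
  have "finite B"
  proof (rule ccontr)
    assume "infinite B"
    then obtain S where S: "finite S" "card S = card Basis ^ card J * card Basis + 1" "S \<subseteq> B"
      using infinite_arbitrarily_large by metis
    then show False
      using card_independent_polyfuns_le[OF S(1) fs.independent_mono[OF B(2) S(3)] _ J] B(1) by auto
  qed
  then show thesis using that B by blast
qed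

lemma dim_polyfuns_le: "finite J \<Longrightarrow> fs.dim (polyfuns J) \<le> card Basis ^ card J * card Basis"
proof -
  assume J: "finite J"
  obtain B where B: "finite B" "fs.independent B" "B \<subseteq> polyfuns J" "polyfuns J \<subseteq> fs.span B"
    "card B = fs.dim (polyfuns J)"
    by (rule polyfuns_basis[OF J])
  then show ?thesis using card_independent_polyfuns_le[OF B(1-3) J] by simp
qed

lemma card_le_dim_polyfuns:
  assumes "finite J" "fs.independent S" "S \<subseteq> polyfuns J"
  shows "card S \<le> fs.dim (polyfuns J)"
proof -
  obtain B where B: "finite B" "fs.independent B" "B \<subseteq> polyfuns J" "polyfuns J \<subseteq> fs.span B"
    "card B = fs.dim (polyfuns J)"
    by (rule polyfuns_basis[OF assms(1)])
  then show ?thesis using fs.independent_span_bound[OF B(1) assms(2)] assms(3) by auto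
qed

section \<open>Triangular systems\<close>

text \<open>Here \<open>p\<close> is the length of the system. Homogeneity of the points lets the
  system be extended, and homogeneity of the values lets graded simplicity be applied to
  them.\<close>

definition triangular :: "nat \<Rightarrow> nat \<Rightarrow> bool" where
  "triangular n p \<longleftrightarrow> (\<exists>F \<phi>. \<forall>i<p. F i \<in> polyfuns {1..n} \<and>
     (\<forall>j\<in>{1..n}. \<phi> i j \<in> homogeneous) \<and> F i (\<phi> i) \<in> homogeneous \<and> F i (\<phi> i) \<noteq> 0 \<and>
     (\<forall>k<i. F i (\<phi> k) = 0))"

text \<open>Vanishing at the \<open>p\<close> earlier points costs at most
  \<open>card Basis * p\<close> dimensions, so a nonzero \<open>G\<close> remains. It is nonzero at
  some homogeneous point, and a projection of it also has a homogeneous value there.\<close>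

lemma triangular_Suc:
  assumes p: "triangular n p" and less: "card Basis * p < fs.dim (polyfuns {1..n})"
  shows "triangular n (Suc p)"
proof -
  define J where "J = {1..n}"
  have J: "finite J" by (simp add: J_def)
  obtain F \<phi> where F: "\<And>i. i < p \<Longrightarrow> F i \<in> polyfuns J \<and>
     (\<forall>j\<in>J. \<phi> i j \<in> homogeneous) \<and> F i (\<phi> i) \<in> homogeneous \<and> F i (\<phi> i) \<noteq> 0 \<and>
     (\<forall>k<i. F i (\<phi> k) = 0)"
    using p unfolding triangular_def J_def by auto
  obtain B where B: "finite B" "fs.independent B" "B \<subseteq> polyfuns J" "polyfuns J \<subseteq> fs.span B"
    "card B = fs.dim (polyfuns J)"
    by (rule polyfuns_basis[OF J])
  obtain S where S: "finite S" "fs.independent S" "S \<subseteq> fs.span B"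
    "\<forall>G\<in>S. \<forall>\<psi>\<in>\<phi> ` {..<p}. G \<psi> = 0"
    "card B \<le> card S + card (\<phi> ` {..<p}) * card Basis"
    by (rule fpair.independent_kernels[where f = "\<lambda>\<phi> F. F \<phi>" and P = "\<phi> ` {..<p}",
          OF linear_eval_at finite_imageI[OF finite_lessThan] B(1,2) finite_Basis span_Basis])
  have "card (\<phi> ` {..<p}) * card Basis \<le> p * card Basis"
    using card_image_le[of "{..<p}" \<phi>] by (intro mult_right_mono) auto
  then have "card B \<le> card S + p * card Basis" using S(5) by linarith
  then have "card S > 0" using B(5) less by (simp add: J_def mult.commute)
  then obtain G where G: "G \<in> S" by fastforce
  have GJ: "G \<in> polyfuns J"
    using G S(3) B(3) fs.span_minimal[OF _ subspace_polyfuns] by blast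
  have "G \<noteq> 0" using G S(2) fs.dependent_zero by blast
  then obtain \<psi> where \<psi>: "\<And>j. j \<in> J \<Longrightarrow> \<psi> j \<in> homogeneous" "G \<psi> \<noteq> 0"
    using polyfuns_eq_0_spanning[OF GJ J span_homogeneous] by (metis ext zero_fun_apply)
  then have "\<forall>j\<in>J. \<exists>t. t \<in> T \<and> \<psi> j \<in> A t" by (auto simp: homogeneous_def)
  then obtain \<tau> where \<tau>: "\<And>j. j \<in> J \<Longrightarrow> \<tau> j \<in> T" "\<And>j. j \<in> J \<Longrightarrow> \<psi> j \<in> A (\<tau> j)" by metis
  obtain r where r: "proj r (G \<psi>) \<noteq> 0"
    using sum_proj[of "G \<psi>"] \<psi>(2) by (metis (mono_tags, lifting) mem_Collect_eq sum.neutral)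
  then have "r \<in> T" using proj_outside by blast
  \<comment> \<open>Arguments are projected to the degrees of \<open>\<psi>\<close> and values to a
    degree in which \<open>G \<psi>\<close> has a nonzero component.\<close>
  define H where "H = (\<lambda>\<phi>. proj r (G (\<lambda>j. proj (\<tau> j) (\<phi> j))))"
  have HJ: "H \<in> polyfuns J" unfolding H_def by (rule polyfuns_component[OF GJ \<tau>(1)])
  have "G (\<lambda>j. proj (\<tau> j) (\<psi> j)) = G \<psi>"
    by (rule polyfuns_cong[OF GJ]) (simp add: proj_component[OF \<tau>(2,1)])
  then have H\<psi>: "H \<psi> = proj r (G \<psi>)" by (simp add: H_def)
  \<comment> \<open>The earlier points are homogeneous: projecting an argument either kills it, and
    then \<open>G\<close> vanishes by linearity, or leaves it unchanged.\<close>
  have H0: "H (\<phi> k) = 0" if k: "k < p" for k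
  proof (cases "\<exists>j\<in>J. proj (\<tau> j) (\<phi> k j) = 0")
    case True
    then show ?thesis using polyfuns_zero[OF GJ] by (auto simp: H_def)
  next
    case False
    have "proj (\<tau> j) (\<phi> k j) = \<phi> k j" if j: "j \<in> J" for j
    proof -
      obtain t where "t \<in> T" "\<phi> k j \<in> A t" using F[OF k] j unfolding homogeneous_def by blast
      then show ?thesis using False j proj_component[of "\<phi> k j" t "\<tau> j"] by (auto split: if_splits)
    qed
    then have "G (\<lambda>j. proj (\<tau> j) (\<phi> k j)) = G (\<phi> k)" by (rule polyfuns_cong[OF GJ])
    also have "\<dots> = 0" using S(4) G k by blast
    finally show ?thesis by (simp add: H_def)
  qed
  have "\<forall>i<Suc p. (F(p := H)) i \<in> polyfuns J \<and> (\<forall>j\<in>J. (\<phi>(p := \<psi>)) i j \<in> homogeneous) \<and>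
    (F(p := H)) i ((\<phi>(p := \<psi>)) i) \<in> homogeneous \<and> (F(p := H)) i ((\<phi>(p := \<psi>)) i) \<noteq> 0 \<and>
    (\<forall>k<i. (F(p := H)) i ((\<phi>(p := \<psi>)) k) = 0)"
    using F HJ H0 H\<psi> r \<psi>(1) proj_homogeneous[OF \<open>r \<in> T\<close>] by (auto simp: less_Suc_eq)
  then show ?thesis unfolding triangular_def J_def by blast
qed

text \<open>A system can be extended as long as its length times \<open>card Basis\<close> is below
  the dimension, so the least length violating this is attained.\<close>

lemma ex_triangular:
  obtains p where "triangular n p" "fs.dim (polyfuns {1..n}) \<le> card Basis * p"
proof -
  have *: "(\<forall>j<p. card Basis * j < fs.dim (polyfuns {1..n})) \<Longrightarrow> triangular n p" for p
  proof (induction p)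
    case 0
    show ?case by (simp add: triangular_def)
  next
    case (Suc p)
    then show ?case using triangular_Suc by (meson less_Suc_eq)
  qed
  have "\<exists>p. fs.dim (polyfuns {1..n}) \<le> card Basis * p"
    using dim_polyfuns_le[of "{1..n}"] by (metis finite_atLeastAtMost mult.commute)
  then have "fs.dim (polyfuns {1..n}) \<le> card Basis * (LEAST p. fs.dim (polyfuns {1..n}) \<le> card Basis * p)"
    by (rule LeastI_ex)
  then show thesis
    by (intro that[OF *]) (auto dest: not_less_Least)
qed

section \<open>Multiplication operators\<close>

text \<open>The letters of the word say whether the next argument, taken from \<open>z\<close> starting at index \<open>j\<close>,
  is multiplied from the right (\<open>True\<close>) or from the left.\<close>

fun act :: "bool list \<Rightarrow> nat \<Rightarrow> (nat \<Rightarrow> 'a) \<Rightarrow> 'a \<Rightarrow> 'a" where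
  "act [] j z a = a"
| "act (b # w) j z a = act w (Suc j) z (if b then mult a (z j) else mult (z j) a)"

lemma act_snoc:
  "act (w @ [b]) j z a =
     (if b then mult (act w j z a) (z (j + length w)) else mult (z (j + length w)) (act w j z a))"
  by (induction w arbitrary: j a) auto

lemma act_cong:
  "(\<And>l. j \<le> l \<Longrightarrow> l < j + length w \<Longrightarrow> z l = z' l) \<Longrightarrow> act w j z a = act w j z' a"
  by (induction w arbitrary: j a) auto

lemma act_zero [simp]: "act w j z 0 = 0"
  by (induction w arbitrary: j) auto

lemma act_homogeneous:
  "a \<in> homogeneous \<Longrightarrow> (\<And>l. z l \<in> homogeneous) \<Longrightarrow> act w j z a \<in> homogeneous"
  by (induction w arbitrary: j a) (auto intro: mult_homogeneous)

lemma polyfuns_act: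
  assumes "F \<in> polyfuns J" "J \<inter> {j..<j + length w} = {}"
  shows "(\<lambda>\<phi>. act w j \<phi> (F \<phi>)) \<in> polyfuns (J \<union> {j..<j + length w})"
  using assms
proof (induction w arbitrary: F J j)
  case (Cons b w)
  have j: "J \<inter> {j} = {}" "{j} \<inter> J = {}" using Cons.prems by auto
  have "(\<lambda>\<phi>. if b then mult (F \<phi>) (\<phi> j) else mult (\<phi> j) (F \<phi>)) \<in> polyfuns (J \<union> {j})"
    using polyfuns_mult[OF Cons.prems(1) polyfuns_variable j(1)]
      polyfuns_mult[OF polyfuns_variable Cons.prems(1) j(2)] by (cases b) (simp_all add: Un_commute)
  moreover have "(J \<union> {j}) \<inter> {Suc j..<Suc j + length w} = {}" using Cons.prems(2) by auto
  ultimately have "(\<lambda>\<phi>. act w (Suc j) \<phi> (if b then mult (F \<phi>) (\<phi> j) else mult (\<phi> j) (F \<phi>)))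
      \<in> polyfuns (J \<union> {j} \<union> {Suc j..<Suc j + length w})"
    by (rule Cons.IH)
  moreover have "J \<union> {j} \<union> {Suc j..<Suc j + length w} = J \<union> {j..<j + length (b # w)}" by auto
  ultimately show ?case by simp
qed simp

text \<open>The element $w_3(w_1(a) w_2(b))$, where the three words read consecutive blocks of
  \<open>z\<close> starting at \<open>j\<close>.\<close>

fun product_act :: "bool list \<times> bool list \<times> bool list \<Rightarrow> nat \<Rightarrow> (nat \<Rightarrow> 'a) \<Rightarrow> 'a \<Rightarrow> 'a \<Rightarrow> 'a" where
  "product_act (w1, w2, w3) j z a b =
     act w3 (j + length w1 + length w2) z (mult (act w1 j z a) (act w2 (j + length w1) z b))"

text \<open>Only the total length is fixed: all shapes consume the same number of new variables, and
  their number depends on \<open>K\<close> alone.\<close>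

definition shapes :: "nat \<Rightarrow> (bool list \<times> bool list \<times> bool list) set" where
  "shapes K = {(w1, w2, w3). length w1 + length w2 + length w3 = K}"

lemma finite_shapes: "finite (shapes K)"
proof (rule finite_subset)
  let ?L = "{w :: bool list. set w \<subseteq> UNIV \<and> length w \<le> K}"
  show "shapes K \<subseteq> ?L \<times> ?L \<times> ?L" by (auto simp: shapes_def)
  show "finite (?L \<times> ?L \<times> ?L)" by (intro finite_cartesian_product finite_lists_length_le) simp_all
qed

lemma product_act_zero [simp]: "product_act u j z 0 b = 0" "product_act u j z a 0 = 0"
  by (cases u; simp)+

lemma product_act_cong:
  assumes "u \<in> shapes K" "\<And>l. j \<le> l \<Longrightarrow> l < j + K \<Longrightarrow> z l = z' l"
  shows "product_act u j z a b = product_act u j z' a b"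
proof -
  obtain w1 w2 w3 where u: "u = (w1, w2, w3)" by (cases u)
  have "length w1 + length w2 + length w3 = K" using assms(1) by (simp add: u shapes_def)
  then have "act w1 j z a = act w1 j z' a"
    "act w2 (j + length w1) z b = act w2 (j + length w1) z' b"
    "act w3 (j + length w1 + length w2) z c = act w3 (j + length w1 + length w2) z' c" for c
    using assms(2) by (auto intro!: act_cong)
  then show ?thesis by (simp add: u)
qed

lemma polyfuns_product_act:
  assumes F: "F \<in> polyfuns I" and G: "G \<in> polyfuns J" and u: "u \<in> shapes K"
    and disj: "I \<inter> J = {}" "I \<inter> {j..<j + K} = {}" "J \<inter> {j..<j + K} = {}"
  shows "(\<lambda>\<phi>. product_act u j \<phi> (F \<phi>) (G \<phi>)) \<in> polyfuns (I \<union> J \<union> {j..<j + K})"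
proof -
  obtain w1 w2 w3 where w: "u = (w1, w2, w3)" by (cases u)
  have K: "length w1 + length w2 + length w3 = K" using u by (simp add: w shapes_def)
  let ?I1 = "{j..<j + length w1}" and ?I2 = "{j + length w1..<j + length w1 + length w2}"
  have "(\<lambda>\<phi>. act w1 j \<phi> (F \<phi>)) \<in> polyfuns (I \<union> ?I1)"
    by (rule polyfuns_act[OF F]) (use disj K in fastforce)
  moreover have "(\<lambda>\<phi>. act w2 (j + length w1) \<phi> (G \<phi>)) \<in> polyfuns (J \<union> ?I2)"
    by (rule polyfuns_act[OF G]) (use disj K in fastforce)
  moreover have "(I \<union> ?I1) \<inter> (J \<union> ?I2) = {}"
    using disj K by fastforce
  ultimately have "(\<lambda>\<phi>. mult (act w1 j \<phi> (F \<phi>)) (act w2 (j + length w1) \<phi> (G \<phi>)))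
      \<in> polyfuns (I \<union> ?I1 \<union> (J \<union> ?I2))"
    by (rule polyfuns_mult)
  then have "(\<lambda>\<phi>. product_act u j \<phi> (F \<phi>) (G \<phi>)) \<in> polyfuns (I \<union> ?I1 \<union> (J \<union> ?I2) \<union>
      {j + length w1 + length w2..<j + length w1 + length w2 + length w3})"
    unfolding w product_act.simps by (rule polyfuns_act) (use disj K in fastforce)
  moreover have "I \<union> ?I1 \<union> (J \<union> ?I2) \<union>
      {j + length w1 + length w2..<j + length w1 + length w2 + length w3} = I \<union> J \<union> {j..<j + K}"
    using K by auto
  ultimately show ?thesis by simp
qed

end

section \<open>Graded-simple algebras\<close>

text \<open>A one-dimensional algebra with zero multiplication also has no non-trivial graded
  ideals; nonzero multiplication is therefore a separate assumption.\<close>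

locale fd_graded_simple_algebra = fd_graded_algebra scale mult T A Basis
  for scale :: "'f::field \<Rightarrow> 'a::ab_group_add \<Rightarrow> 'a" and mult :: "'a \<Rightarrow> 'a \<Rightarrow> 'a"
    and T :: "'t set" and A :: "'t \<Rightarrow> 'a set" and Basis :: "'a set" +
  assumes no_ideals: "\<nexists>I. nontrivial_graded_ideal I"
    and mult_nonzero: "\<exists>x y. mult x y \<noteq> 0"
begin

lemma span_ideal_UNIV:
  assumes "S \<subseteq> homogeneous" "a \<in> S" "a \<noteq> 0"
    and "\<And>x z. x \<in> S \<Longrightarrow> z \<in> homogeneous \<Longrightarrow> mult x z \<in> span S \<and> mult z x \<in> span S"
  shows "span S = UNIV"
proof -
  have "graded_ideal (span S)" using assms by (intro graded_ideal_span)
  moreover have "span S \<noteq> {0}" using span_base[OF assms(2)] assms(3) by blast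
  ultimately show ?thesis using no_ideals unfolding nontrivial_graded_ideal_def by blast
qed

text \<open>Otherwise the line through \<open>a\<close> would be a graded ideal, hence the whole
  algebra, and all products would vanish.\<close>

lemma no_annihilator:
  assumes a: "a \<in> homogeneous" "a \<noteq> 0"
  shows "\<exists>z\<in>homogeneous. mult a z \<noteq> 0 \<or> mult z a \<noteq> 0"
proof (rule ccontr)
  assume "\<not> ?thesis"
  then have 0: "mult a z = 0 \<and> mult z a = 0" if "z \<in> homogeneous" for z using that by blast
  have "span {a} = UNIV"
    by (rule span_ideal_UNIV) (use a 0 span_zero in auto)
  then have "mult x y \<in> {0}" for x y
    by (rule mult_in_subspace[OF _ span_homogeneous]) (use 0 in auto)
  then show False using mult_nonzero by blast
qed

text \<open>Nonzero multiplications are appended one at a time. The length is exactly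
  \<open>k\<close>, so words can be padded to a prescribed length.\<close>

lemma act_nonzero:
  assumes "a \<in> homogeneous" "a \<noteq> 0"
  shows "\<exists>w z. length w = k \<and> (\<forall>l. z l \<in> homogeneous) \<and> act w j z a \<noteq> 0"
  using assms
proof (induction k arbitrary: a j)
  case 0
  then show ?case by (intro exI[of _ "[]"] exI[of _ "\<lambda>_. a"]) auto
next
  case (Suc k)
  obtain x where x: "x \<in> homogeneous" "mult a x \<noteq> 0 \<or> mult x a \<noteq> 0"
    using no_annihilator Suc.prems by blast
  define b where "b \<longleftrightarrow> mult a x \<noteq> 0"
  define c where "c = (if b then mult a x else mult x a)"
  have "c \<in> homogeneous" "c \<noteq> 0"
    using x Suc.prems by (auto simp: c_def b_def intro: mult_homogeneous)
  from Suc.IH[OF this, of "Suc j"] obtain w z where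
    w: "length w = k" "\<And>l. z l \<in> homogeneous" "act w (Suc j) z c \<noteq> 0" by blast
  \<comment> \<open>The new factor sits at index \<open>j\<close>, which the remaining word, reading
    from \<open>Suc j\<close>, does not see.\<close>
  define z' where "z' = z(j := x)"
  have "act (b # w) j z' a = act w (Suc j) z' c" by (simp add: c_def z'_def)
  also have "\<dots> = act w (Suc j) z c" by (rule act_cong) (simp add: z'_def)
  finally have "act (b # w) j z' a \<noteq> 0" using w(3) by simp
  moreover have "length (b # w) = Suc k" "\<forall>l. z' l \<in> homogeneous" using w x by (simp_all add: z'_def)
  ultimately show ?case by blast
qed

text \<open>The spans for words of length at most \<open>k\<close> increase with \<open>k\<close>.
  Once two consecutive ones agree, the span is a nonzero graded ideal and so everything; strict
  growth can last for fewer than \<open>card Basis\<close> steps.\<close>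

lemma span_act_UNIV:
  assumes a: "a \<in> homogeneous" "a \<noteq> 0"
  shows "span {act w j z a | w z. length w \<le> card Basis \<and> (\<forall>l. z l \<in> homogeneous)} = UNIV"
proof -
  define S where "S k = {act w j z a | w z. length w \<le> k \<and> (\<forall>l. z l \<in> homogeneous)}" for k
  have S_hom: "S k \<subseteq> homogeneous" for k
    using a(1) by (auto simp: S_def intro: act_homogeneous)
  have S_mono: "S k \<subseteq> S (Suc k)" for k by (auto simp: S_def) (metis le_SucI)
  have a_S: "a \<in> S k" for k
    using a(1) by (auto simp: S_def intro!: exI[of _ "[]"] exI[of _ "\<lambda>_. a"])
  have S_step: "(if b then mult x y else mult y x) \<in> S (Suc k)"
    if "x \<in> S k" and y: "y \<in> homogeneous" for x y b k
  proof -
    obtain w z where w: "x = act w j z a" "length w \<le> k" "\<And>l. z l \<in> homogeneous"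
      using \<open>x \<in> S k\<close> by (auto simp: S_def)
    define z' where "z' = z(j + length w := y)"
    have "act w j z' a = x" unfolding w(1) by (rule act_cong) (auto simp: z'_def)
    then have "act (w @ [b]) j z' a = (if b then mult x y else mult y x)"
      by (simp add: act_snoc z'_def)
    moreover have "length (w @ [b]) \<le> Suc k" "\<forall>l. z' l \<in> homogeneous"
      using w y by (auto simp: z'_def)
    ultimately show ?thesis unfolding S_def mem_Collect_eq by metis
  qed
  have stable: "span (S k) = UNIV" if sub: "span (S (Suc k)) \<subseteq> span (S k)" for k
  proof (rule span_ideal_UNIV[OF S_hom a_S a(2)])
    fix x z assume x: "x \<in> S k" and z: "z \<in> homogeneous"
    have "mult x z \<in> S (Suc k)" "mult z x \<in> S (Suc k)"
      using S_step[OF x z, of True] S_step[OF x z, of False] by simp_all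
    then show "mult x z \<in> span (S k) \<and> mult z x \<in> span (S k)"
      using sub span_base by blast
  qed
  \<comment> \<open>The inequality is strict because \<open>S 0\<close> already contains the nonzero
    \<open>a\<close>; at \<open>k = card Basis\<close> the second alternative is impossible.\<close>
  have "span (S k) = UNIV \<or> k < dim (S k)" for k
  proof (induction k)
    case 0
    have "dim {a} \<le> dim (S 0)" using a_S by (intro dim_subset) auto
    then show ?case using a(2) by simp
  next
    case (Suc k)
    show ?case
    proof (cases "span (S (Suc k)) \<subseteq> span (S k)")
      case True
      then show ?thesis using stable span_mono[OF S_mono, of k] by blast
    next
      case False
      then have "span (S k) \<subset> span (S (Suc k))" using span_mono[OF S_mono, of k] by blast
      then have "dim (S k) < dim (S (Suc k))"
        using dim_psubset[of "S k" "S (Suc k)"] by simp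
      then show ?thesis using Suc \<open>span (S k) \<subset> span (S (Suc k))\<close> by auto
    qed
  qed
  from this[of "card Basis"] show ?thesis
    using dim_subset_UNIV[of "S (card Basis)"] dim_subset[of "S (card Basis)" UNIV]
    unfolding S_def[symmetric] by auto
qed

text \<open>The elements $w_1(a)$ span the algebra, so one of them has a nonzero product with some
  \<open>y\<close>; the elements $w_2(b)$ span it too, so \<open>y\<close> can be replaced by one of
  these. The outer word is then padding.\<close>

lemma ex_product_act_nonzero:
  assumes a: "a \<in> homogeneous" "a \<noteq> 0" and b: "b \<in> homogeneous" "b \<noteq> 0"
  shows "\<exists>u z. u \<in> shapes (2 * card Basis) \<and> (\<forall>l. z l \<in> homogeneous) \<and> product_act u j z a b \<noteq> 0"
proof -
  have "\<exists>w1 z1 y. length w1 \<le> card Basis \<and> (\<forall>l. z1 l \<in> homogeneous) \<and> mult (act w1 j z1 a) y \<noteq> 0"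
  proof (rule ccontr)
    assume "\<not> ?thesis"
    then have 0: "mult x y = 0"
      if "x \<in> {act w j z a | w z. length w \<le> card Basis \<and> (\<forall>l. z l \<in> homogeneous)}" for x y
      using that by blast
    have "mult x y \<in> {0}" for x y
      by (rule mult_in_subspace[OF span_act_UNIV[OF a, of j] span_UNIV]) (use 0 in auto)
    then show False using mult_nonzero by blast
  qed
  then obtain w1 z1 y where w1: "length w1 \<le> card Basis" "\<And>l. z1 l \<in> homogeneous"
    "mult (act w1 j z1 a) y \<noteq> 0" by blast
  define x where "x = act w1 j z1 a"
  have x: "x \<in> homogeneous" using a w1 by (simp add: x_def act_homogeneous)
  define j2 where "j2 = j + length w1"
  have "\<exists>w2 z2. length w2 \<le> card Basis \<and> (\<forall>l. z2 l \<in> homogeneous) \<and> mult x (act w2 j2 z2 b) \<noteq> 0"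
  proof (rule ccontr)
    assume "\<not> ?thesis"
    then have 0: "mult x y = 0"
      if "y \<in> {act w j2 z b | w z. length w \<le> card Basis \<and> (\<forall>l. z l \<in> homogeneous)}" (is "y \<in> ?S") for y
      using that by blast
    interpret l: Vector_Spaces.linear scale scale "\<lambda>y. mult x y" by (rule linear_mult_right)
    have "mult x y = 0"
      using l.eq_0_on_span[of ?S y] 0 span_act_UNIV[OF b, of j2] by blast
    then show False using w1(3) by (simp add: x_def)
  qed
  then obtain w2 z2 where w2: "length w2 \<le> card Basis" "\<And>l. z2 l \<in> homogeneous"
    "mult x (act w2 j2 z2 b) \<noteq> 0" by blast
  define c where "c = mult x (act w2 j2 z2 b)"
  have c: "c \<in> homogeneous" "c \<noteq> 0"
    using x b w2 by (simp_all add: c_def act_homogeneous mult_homogeneous)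
  define j3 where "j3 = j2 + length w2"
  \<comment> \<open>Each of the first two words has length at most \<open>card Basis\<close>; the
    third brings the total to exactly twice that.\<close>
  obtain w3 z3 where w3: "length w3 = 2 * card Basis - length w1 - length w2"
    "\<And>l. z3 l \<in> homogeneous" "act w3 j3 z3 c \<noteq> 0"
    using act_nonzero[OF c] by blast
  \<comment> \<open>The three words read disjoint blocks of indices, so their arguments can be glued
    into one sequence.\<close>
  define z where "z l = (if l < j2 then z1 l else if l < j3 then z2 l else z3 l)" for l
  have "act w1 j z a = x" unfolding x_def by (rule act_cong) (simp add: z_def j2_def)
  moreover have "act w2 j2 z b = act w2 j2 z2 b" by (rule act_cong) (simp add: z_def j3_def)
  moreover have "act w3 j3 z c = act w3 j3 z3 c" by (rule act_cong) (simp add: z_def j3_def)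
  ultimately have "product_act (w1, w2, w3) j z a b \<noteq> 0"
    using w3(3) by (simp add: c_def j3_def j2_def)
  moreover have "(w1, w2, w3) \<in> shapes (2 * card Basis)" using w1 w2 w3 by (simp add: shapes_def)
  moreover have "\<forall>l. z l \<in> homogeneous" using w1 w2 w3 by (simp add: z_def)
  ultimately show ?thesis by blast
qed

text \<open>For a fixed shape, the functions built from two triangular systems are triangular for the
  product order on pairs of indices.\<close>

lemma triangular_product:
  assumes p: "triangular m p" and q: "triangular n q"
  defines "K \<equiv> 2 * card Basis"
  shows "p * q \<le> card (shapes K) * fs.dim (polyfuns {1..m + n + K})"
proof -
  obtain F \<phi> where F: "\<And>i. i < p \<Longrightarrow> F i \<in> polyfuns {1..m}"
    "\<And>i. i < p \<Longrightarrow> F i (\<phi> i) \<in> homogeneous" "\<And>i. i < p \<Longrightarrow> F i (\<phi> i) \<noteq> 0"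
    "\<And>i k. i < p \<Longrightarrow> k < i \<Longrightarrow> F i (\<phi> k) = 0"
    using p unfolding triangular_def by blast
  obtain G \<psi> where G: "\<And>i. i < q \<Longrightarrow> G i \<in> polyfuns {1..n}"
    "\<And>i. i < q \<Longrightarrow> G i (\<psi> i) \<in> homogeneous" "\<And>i. i < q \<Longrightarrow> G i (\<psi> i) \<noteq> 0"
    "\<And>i k. i < q \<Longrightarrow> k < i \<Longrightarrow> G i (\<psi> k) = 0"
    using q unfolding triangular_def by blast
  define I where "I = {..<p} \<times> {..<q}"
  have I: "finite I" "card I = p * q" by (simp_all add: I_def)
  \<comment> \<open>Indices \<open>1..m\<close> serve the first system and
    \<open>m + 1..m + n\<close> the second; \<open>j0\<close> is the first of the \<open>K\<close>
    new ones.\<close>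
  define j0 where "j0 = Suc (m + n)"
  have "\<forall>a\<in>I. \<exists>u z. u \<in> shapes K \<and>
      product_act u j0 z (F (fst a) (\<phi> (fst a))) (G (snd a) (\<psi> (snd a))) \<noteq> 0"
  proof
    fix a assume "a \<in> I"
    then have a: "fst a < p" "snd a < q" by (auto simp: I_def)
    show "\<exists>u z. u \<in> shapes K \<and>
      product_act u j0 z (F (fst a) (\<phi> (fst a))) (G (snd a) (\<psi> (snd a))) \<noteq> 0"
      using ex_product_act_nonzero[OF F(2,3)[OF a(1)] G(2,3)[OF a(2)], of j0]
      unfolding K_def by blast
  qed
  then obtain u z where uz: "\<And>a. a \<in> I \<Longrightarrow> u a \<in> shapes K"
      "\<And>a. a \<in> I \<Longrightarrow> product_act (u a) j0 (z a) (F (fst a) (\<phi> (fst a))) (G (snd a) (\<psi> (snd a))) \<noteq> 0"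
    by metis
  define N where "N = fs.dim (polyfuns {1..m + n + K})"
  have fiber: "card {a \<in> I. u a = v} \<le> N" if v: "v \<in> shapes K" for v
  proof -
    define H where "H a = (\<lambda>\<chi>. product_act v j0 \<chi> (F (fst a) \<chi>) (G (snd a) (\<chi> \<circ> (\<lambda>l. l + m))))" for a
    \<comment> \<open>The test point of a pair joins the two points of the systems with the extra
      factors chosen for that pair.\<close>
    define \<chi> where "\<chi> a l =
      (if l \<le> m then \<phi> (fst a) l else if l \<le> m + n then \<psi> (snd a) (l - m) else z a l)" for a l
    have HV: "H a \<in> polyfuns {1..m + n + K}" if "a \<in> I" for a
    proof -
      have ij: "fst a < p" "snd a < q" using that by (auto simp: I_def)
      have *: "(\<lambda>l. l + m) ` {1..n} = {m + 1..m + n}" by (simp add: add.commute)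
      have "(\<lambda>\<chi>. G (snd a) (\<chi> \<circ> (\<lambda>l. l + m))) \<in> polyfuns {m + 1..m + n}"
        using polyfuns_map_indices[OF G(1)[OF ij(2)], of "\<lambda>l. l + m"] unfolding * by simp
      moreover have "{1..m} \<inter> {m + 1..m + n} = {}" "{1..m} \<inter> {j0..<j0 + K} = {}"
        "{m + 1..m + n} \<inter> {j0..<j0 + K} = {}" by (auto simp: j0_def)
      ultimately have "H a \<in> polyfuns ({1..m} \<union> {m + 1..m + n} \<union> {j0..<j0 + K})"
        unfolding H_def by (intro polyfuns_product_act[OF F(1)[OF ij(1)] _ v])
      moreover have "{1..m} \<union> {m + 1..m + n} \<union> {j0..<j0 + K} = {1..m + n + K}" by (auto simp: j0_def)
      ultimately show ?thesis by simp
    qed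
    have H_eval: "H b (\<chi> a) =
        product_act v j0 (z a) (F (fst b) (\<phi> (fst a))) (G (snd b) (\<psi> (snd a)))"
      if "a \<in> I" "b \<in> I" for a b
    proof -
      have "F (fst b) (\<chi> a) = F (fst b) (\<phi> (fst a))"
        using that by (intro polyfuns_cong[OF F(1)]) (auto simp: I_def \<chi>_def)
      moreover have "G (snd b) (\<chi> a \<circ> (\<lambda>l. l + m)) = G (snd b) (\<psi> (snd a))"
        using that by (intro polyfuns_cong[OF G(1)]) (auto simp: I_def \<chi>_def)
      moreover have "product_act v j0 (\<chi> a) x y = product_act v j0 (z a) x y" for x y
        by (rule product_act_cong[OF v]) (auto simp: \<chi>_def j0_def)
      ultimately show ?thesis by (simp add: H_def)
    qed
    let ?I = "{a \<in> I. u a = v}"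
    have nz: "H a (\<chi> a) \<noteq> 0" if "a \<in> ?I" for a
      using uz(2)[of a] that by (simp add: H_eval)
    have tri: "H b (\<chi> a) = 0"
      if ab: "a \<in> ?I" "b \<in> ?I" "b \<noteq> a" "fst a + snd a \<le> fst b + snd b" for a b
    proof -
      \<comment> \<open>A different pair whose coordinate sum is not smaller exceeds
        \<open>a\<close> in some coordinate, and there the corresponding triangular system
        vanishes.\<close>
      have "fst a < fst b \<or> snd a < snd b" using ab(3,4) by (cases a; cases b) auto
      then have "F (fst b) (\<phi> (fst a)) = 0 \<or> G (snd b) (\<psi> (snd a)) = 0"
        using F(4) G(4) ab by (auto simp: I_def)
      then show ?thesis using H_eval[of a b] ab by auto
    qed
    have fin: "finite ?I" using I(1) by simp
    note ti = fpair.triangular_independent[where e = "\<lambda>a F. F (\<chi> a)" and H = H and I = ?I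
        and \<mu> = "\<lambda>a. fst a + snd a", OF linear_eval_at nz tri fin]
    have "fs.independent (H ` ?I)" "card (H ` ?I) = card ?I" using ti by blast+
    then show ?thesis
      using card_le_dim_polyfuns[of "{1..m + n + K}" "H ` ?I"] HV unfolding N_def by fastforce
  qed
  \<comment> \<open>Independence holds only within one shape, which accounts for the factor
    \<open>card (shapes K)\<close>.\<close>
  have "I = (\<Union>v\<in>shapes K. {a \<in> I. u a = v})" using uz(1) by blast
  then have "card I \<le> (\<Sum>v\<in>shapes K. card {a \<in> I. u a = v})"
    using card_UN_le[OF finite_shapes[of K], of "\<lambda>v. {a \<in> I. u a = v}"] by simp
  also have "\<dots> \<le> (\<Sum>v\<in>shapes K. N)" using fiber by (intro sum_mono)
  finally show ?thesis using I(2) by (simp add: N_def)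
qed

text \<open>Replacing each of the two dimensions by the length of a triangular system costs a factor
  \<open>card Basis\<close>, so $C$ is \<open>(card Basis)\<^sup>2\<close> times the number of
  shapes, and $K$ is \<open>2 * card Basis\<close>.\<close>

lemma dim_polyfuns_supermultiplicative:
  obtains C K where "\<And>m n. fs.dim (polyfuns {1..m}) * fs.dim (polyfuns {1..n})
    \<le> C * fs.dim (polyfuns {1..m + n + K})"
proof (rule that)
  fix m n
  let ?d = "card Basis"
  obtain p where p: "triangular m p" "fs.dim (polyfuns {1..m}) \<le> ?d * p" by (rule ex_triangular)
  obtain q where q: "triangular n q" "fs.dim (polyfuns {1..n}) \<le> ?d * q" by (rule ex_triangular)
  have "fs.dim (polyfuns {1..m}) * fs.dim (polyfuns {1..n}) \<le> (?d * p) * (?d * q)"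
    by (rule mult_le_mono[OF p(2) q(2)])
  also have "\<dots> = ?d\<^sup>2 * (p * q)" by (simp add: power2_eq_square)
  also have "\<dots> \<le> ?d\<^sup>2 * (card (shapes (2 * ?d)) * fs.dim (polyfuns {1..m + n + 2 * ?d}))"
    by (rule mult_le_mono2[OF triangular_product[OF p(1) q(1)]])
  finally show "fs.dim (polyfuns {1..m}) * fs.dim (polyfuns {1..n})
    \<le> (?d\<^sup>2 * card (shapes (2 * ?d))) * fs.dim (polyfuns {1..m + n + 2 * ?d})"
    by (simp add: mult_ac)
qed

text \<open>Starting from a nonzero homogeneous element, \<open>n - 1\<close> successive
  multiplications can be kept nonzero. Positivity is what allows taking logarithms of the
  codimensions.\<close>

lemma dim_polyfuns_pos:
  assumes "n \<ge> 1"
  shows "fs.dim (polyfuns {1..n}) > 0"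
proof -
  have "\<not> homogeneous \<subseteq> {0}"
  proof
    assume "homogeneous \<subseteq> {0}"
    then have "span homogeneous \<subseteq> {0}" by (rule span_minimal) simp
    then show False using span_homogeneous mult_nonzero by (metis UNIV_I mult_zero_left singletonD subsetD)
  qed
  then obtain a where a: "a \<in> homogeneous" "a \<noteq> 0" by blast
  obtain w z where w: "length w = n - 1" "act w 2 z a \<noteq> 0" using act_nonzero[OF a] by blast
  \<comment> \<open>Index 1 holds the starting element, so the word of length \<open>n - 1\<close>
    reads the indices \<open>2..n\<close>.\<close>
  define F where "F = (\<lambda>\<phi>. act w 2 \<phi> (\<phi> 1))"
  have "F \<in> polyfuns ({1} \<union> {2..<2 + length w})"
    unfolding F_def by (rule polyfuns_act[OF polyfuns_variable]) auto
  moreover have "{1} \<union> {2..<2 + length w} = {1..n}" using w(1) assms by auto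
  ultimately have "F \<in> polyfuns {1..n}" by simp
  moreover have "F (z(1 := a)) = act w 2 z a" unfolding F_def by (simp, rule act_cong) auto
  then have "F \<noteq> 0" using w(2) by auto
  ultimately have "card {F} \<le> fs.dim (polyfuns {1..n})"
    by (intro card_le_dim_polyfuns) (simp, simp only: fs.dependent_single simp_thms, blast)
  moreover have "card {F} = 1" by simp
  ultimately show ?thesis by linarith
qed

end

section \<open>Codimensions as dimensions of spaces of functions\<close>

context fd_graded_algebra
begin

definition eval_fun :: "(('t \<times> nat) monomial \<Rightarrow>\<^sub>0 'f) \<Rightarrow> (nat \<Rightarrow> 'a) \<Rightarrow> 'a" where
  "eval_fun f = (\<lambda>\<phi>. eval_poly scale mult (subst \<phi>) f)"

lemma eval_poly_superset:
  assumes "finite S" "Poly_Mapping.keys f \<subseteq> S"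
  shows "eval_poly scale mult \<rho> f =
    (\<Sum>m\<in>S. scale (Poly_Mapping.lookup f m) (eval_monomial mult \<rho> m))"
  unfolding eval_poly_def
  by (rule sum.mono_neutral_left) (use assms in \<open>auto simp: in_keys_iff\<close>)

lemma linear_eval_fun: "Vector_Spaces.linear free_scale fscale eval_fun"
  unfolding Vector_Spaces.linear_iff
proof (intro conjI allI fs.vector_space_axioms free.vector_space_axioms)
  fix f g :: "('t \<times> nat) monomial \<Rightarrow>\<^sub>0 'f" and c :: 'f
  define S where "S = Poly_Mapping.keys f \<union> Poly_Mapping.keys g"
  have S: "finite S" "Poly_Mapping.keys f \<subseteq> S" "Poly_Mapping.keys g \<subseteq> S"
    "Poly_Mapping.keys (f + g) \<subseteq> S" "Poly_Mapping.keys (free_scale c f) \<subseteq> S"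
    using Poly_Mapping.keys_add[of f g] by (auto simp: S_def in_keys_iff)
  show "eval_fun (f + g) = eval_fun f + eval_fun g"
    unfolding eval_fun_def fun_eq_iff plus_fun_apply
    by (simp only: eval_poly_superset[OF S(1,2)] eval_poly_superset[OF S(1,3)]
        eval_poly_superset[OF S(1,4)] lookup_add scale_left_distrib sum.distrib simp_thms)
  show "eval_fun (free_scale c f) = fscale c (eval_fun f)"
    unfolding eval_fun_def fun_eq_iff fscale_apply
    by (simp only: eval_poly_superset[OF S(1,2)] eval_poly_superset[OF S(1,5)]
        lookup_free_scale scale_scale[symmetric] scale_sum_right simp_thms)
qed

lemma eval_fun_single: "eval_fun (Poly_Mapping.single m 1) = ev m"
  by (rule ext) (simp add: eval_fun_def ev_def eval_poly_def)

text \<open>Listing the indices \<open>1..n\<close> without repetition is the same as giving a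
  permutation, read off from the positions of the letters.\<close>

lemma multilinear_monomials_eq: "multilinear_monomials T n = index_monomials {1..n}"
proof (intro equalityI subsetI)
  fix m assume "m \<in> multilinear_monomials T n"
  then obtain \<sigma> \<tau> where \<sigma>: "\<sigma> permutes {1..n}" "\<forall>i\<in>{1..n}. \<tau> i \<in> T"
    "letters m = map (\<lambda>i. (\<tau> i, \<sigma> i)) [1..<Suc n]"
    unfolding multilinear_monomials_def by auto
  have 1: "map snd (letters m) = map \<sigma> [1..<Suc n]" using \<sigma>(3) by (simp add: o_def del: upt_Suc)
  have s: "set [1..<Suc n] = {1..n}" by auto
  have "distinct (map snd (letters m))"
    unfolding 1 distinct_map using permutes_inj_on[OF \<sigma>(1)] by (simp del: upt_Suc)
  moreover have "snd ` set (letters m) = {1..n}"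
    using \<sigma>(3) permutes_image[OF \<sigma>(1)] s by (simp add: image_image del: upt_Suc)
  moreover have "fst ` set (letters m) \<subseteq> T"
    using \<sigma>(2,3) s by (auto simp del: upt_Suc)
  ultimately show "m \<in> index_monomials {1..n}" unfolding index_monomials_def by blast
next
  fix m assume "m \<in> index_monomials {1..n}"
  then have m: "distinct (map snd (letters m))" "snd ` set (letters m) = {1..n}"
    "fst ` set (letters m) \<subseteq> T"
    unfolding index_monomials_def by auto
  define xs where "xs = letters m"
  have len: "length xs = n"
    using distinct_card[OF m(1)] m(2) by (simp add: xs_def)
  \<comment> \<open>List positions start at 0, hence \<open>i - 1\<close>; outside
    \<open>{1..n}\<close> the identity is required by \<open>permutes\<close>.\<close>
  define \<sigma> where "\<sigma> i = (if i \<in> {1..n} then snd (xs ! (i - 1)) else i)" for i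
  define \<tau> where "\<tau> i = fst (xs ! (i - 1))" for i
  have xs: "xs = map (\<lambda>i. (\<tau> i, \<sigma> i)) [1..<Suc n]"
    by (rule nth_equalityI) (auto simp: len \<sigma>_def \<tau>_def simp del: upt_Suc)
  have "map snd xs = map \<sigma> [1..<Suc n]" by (subst xs) (simp add: o_def del: upt_Suc)
  then have "distinct (map \<sigma> [1..<Suc n])" "set (map \<sigma> [1..<Suc n]) = {1..n}"
    using m(1,2) xs_def by (metis, metis list.set_map)
  then have "bij_betw \<sigma> {1..n} {1..n}"
    by (simp add: bij_betw_def distinct_map atLeastLessThanSuc_atLeastAtMost del: upt_Suc)
  then have "\<sigma> permutes {1..n}" by (rule bij_imp_permutes) (auto simp: \<sigma>_def)
  moreover have "\<forall>i\<in>{1..n}. \<tau> i \<in> T"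
  proof
    fix i assume "i \<in> {1..n}"
    then have "xs ! (i - 1) \<in> set xs" by (intro nth_mem) (auto simp: len)
    then show "\<tau> i \<in> T" using m(3) by (auto simp: \<tau>_def xs_def)
  qed
  ultimately show "m \<in> multilinear_monomials T n"
    using xs unfolding multilinear_monomials_def xs_def by blast
qed

lemma eval_fun_multilinear_space: "eval_fun ` multilinear_space T n = polyfuns {1..n}"
proof -
  interpret l: Vector_Spaces.linear free_scale fscale eval_fun by (rule linear_eval_fun)
  have "eval_fun ` (\<lambda>m. Poly_Mapping.single m 1) ` index_monomials {1..n} = ev ` index_monomials {1..n}"
    by (simp add: image_image eval_fun_single)
  then show ?thesis
    unfolding multilinear_space_def multilinear_monomials_eq l.span_image[symmetric] polyfuns_def by simp
qed

lemma keys_multilinear_space: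
  fixes f :: "('t \<times> nat) monomial \<Rightarrow>\<^sub>0 'f"
  assumes "f \<in> multilinear_space T n"
  shows "Poly_Mapping.keys f \<subseteq> index_monomials {1..n}"
proof -
  let ?S = "{f :: ('t \<times> nat) monomial \<Rightarrow>\<^sub>0 'f. Poly_Mapping.keys f \<subseteq> index_monomials {1..n}}"
  have "free.subspace ?S"
  proof (rule free.subspaceI)
    show "x + y \<in> ?S" if "x \<in> ?S" "y \<in> ?S" for x y
      using Poly_Mapping.keys_add[of x y] that by auto
    show "free_scale c x \<in> ?S" if "x \<in> ?S" for c x
      using that by (auto simp: in_keys_iff)
  qed simp
  then have "free.span ((\<lambda>m. Poly_Mapping.single m (1 :: 'f)) ` index_monomials {1..n}) \<subseteq> ?S"
    by (intro free.span_minimal) auto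
  then show ?thesis using assms unfolding multilinear_space_def multilinear_monomials_eq by blast
qed

text \<open>Every \<open>subst \<phi>\<close> is a graded substitution. Conversely, on the graded
  variables each graded substitution has this form, since its values in degrees outside
  \<open>supp\<close> are 0.\<close>

lemma graded_identities_multilinear:
  assumes f: "f \<in> multilinear_space T n"
  shows "f \<in> graded_identities \<longleftrightarrow> eval_fun f = 0"
proof
  assume id: "f \<in> graded_identities"
  have "eval_fun f \<phi> = 0" for \<phi>
    using id unfolding graded_identities_def eval_fun_def graded_variables_def
    by (auto simp: subst_def proj_in)
  then show "eval_fun f = 0" by (simp add: fun_eq_iff)
next
  assume 0: "eval_fun f = 0"
  have letters: "set (letters m) \<subseteq> graded_variables T" if "m \<in> Poly_Mapping.keys f" for m
  proof -
    have "snd ` set (letters m) = {1..n}" "fst ` set (letters m) \<subseteq> T"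
      using keys_multilinear_space[OF f] that unfolding index_monomials_def by auto
    then show ?thesis unfolding graded_variables_def by force
  qed
  moreover have "eval_poly scale mult \<rho> f = 0"
    if \<rho>: "\<forall>(t, i)\<in>graded_variables T. \<rho> (t, i) \<in> A t" for \<rho>
  proof -
    \<comment> \<open>The sum is restricted to \<open>supp\<close> to be finite; its components
      recover the values of \<open>\<rho>\<close>.\<close>
    define \<phi> where "\<phi> i = (\<Sum>s\<in>supp. \<rho> (s, i))" for i
    have "subst \<phi> (t, i) = \<rho> (t, i)" if ti: "(t, i) \<in> graded_variables T" for t i
    proof -
      interpret l: Vector_Spaces.linear scale scale "proj t" by (rule linear_proj)
      have t: "t \<in> T" using ti by (simp add: graded_variables_def)
      have \<rho>A: "\<rho> (s, i) \<in> A s" if "s \<in> T" for s using \<rho> that ti by (auto simp: graded_variables_def)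
      have "subst \<phi> (t, i) = (\<Sum>s\<in>supp. proj t (\<rho> (s, i)))"
        by (simp add: subst_def \<phi>_def l.sum)
      also have "\<dots> = (\<Sum>s\<in>supp. if t = s then \<rho> (s, i) else 0)"
        using supp_subset by (intro sum.cong refl proj_component \<rho>A) auto
      also have "\<dots> = (if t \<in> supp then \<rho> (t, i) else 0)" by (simp add: finite_supp)
      also have "\<dots> = \<rho> (t, i)"
        using proj_component[OF \<rho>A[OF t] t, of t] proj_not_supp[of t "\<rho> (t, i)"] by auto
      finally show ?thesis .
    qed
    then have "eval_monomial mult \<rho> m = eval_monomial mult (subst \<phi>) m"
      if "m \<in> Poly_Mapping.keys f" for m
      using letters[OF that] by (intro eval_monomial_cong) auto
    then have "eval_poly scale mult \<rho> f = eval_fun f \<phi>"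
      unfolding eval_poly_def eval_fun_def by (intro sum.cong) auto
    then show ?thesis using 0 by simp
  qed
  ultimately show "f \<in> graded_identities"
    unfolding graded_identities_def graded_free_algebra_def by blast
qed

text \<open>On the multilinear space, the identities are the kernel of \<open>eval_fun\<close>,
  whose image is \<open>polyfuns {1..n}\<close>.\<close>

lemma graded_codimension_eq_dim: "graded_codimension n = fs.dim (polyfuns {1..n})"
proof -
  interpret E: vector_space_pair "free_scale :: 'f \<Rightarrow> (('t \<times> nat) monomial \<Rightarrow>\<^sub>0 'f) \<Rightarrow> _" fscale ..
  obtain B where B: "finite B" "fs.independent B" "B \<subseteq> polyfuns {1..n}"
    "polyfuns {1..n} \<subseteq> fs.span B" "card B = fs.dim (polyfuns {1..n})"
    by (rule polyfuns_basis[OF finite_atLeastAtMost])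
  have "free.quotient_dim (multilinear_space T n) (multilinear_space T n \<inter> graded_identities) =
      fs.dim (eval_fun ` multilinear_space T n)"
  proof (rule E.quotient_dim_kernel[OF linear_eval_fun _ _ B(1)])
    show "free.subspace (multilinear_space T n)"
      unfolding multilinear_space_def by (rule free.subspace_span)
    show "multilinear_space T n \<inter> graded_identities = multilinear_space T n \<inter> {x. eval_fun x = 0}"
      using graded_identities_multilinear by blast
    show "eval_fun ` multilinear_space T n \<subseteq> fs.span B"
      using B(4) unfolding eval_fun_multilinear_space .
  qed
  then show ?thesis unfolding graded_codimension_def eval_fun_multilinear_space .
qed

text \<open>A monomial with at least two letters is a product, so its function is zero.\<close>

lemma graded_codimension_zero_mult:
  assumes 0: "\<And>x y. mult x y = 0" and n: "n \<ge> 2"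
  shows "graded_codimension n = 0"
proof -
  have "ev m = 0" if m: "m \<in> index_monomials {1..n}" for m
  proof (cases m)
    case (Var v)
    then have "{1..n} = {snd v}" using m by (auto simp: index_monomials_def)
    then have "card {1..n} = 1" by simp
    then show ?thesis using n by simp
  next
    case (Prod p q)
    then show ?thesis by (auto simp: fun_eq_iff ev_def 0)
  qed
  then have "polyfuns {1..n} \<subseteq> fs.span {}"
    unfolding polyfuns_def by (intro fs.span_minimal fs.subspace_span) (auto simp: fs.span_zero)
  then have "fs.dim (polyfuns {1..n}) \<le> card ({} :: ((nat \<Rightarrow> 'a) \<Rightarrow> 'a) set)"
    by (rule fs.dim_le_card) simp
  then show ?thesis unfolding graded_codimension_eq_dim by simp
qed

end

section \<open>Convergence of the roots of the codimensions\<close>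

context fd_graded_simple_algebra
begin

lemma convergent_root_codimension: "convergent (\<lambda>n. root n (real (graded_codimension n)))"
proof -
  obtain C K where super: "\<And>m n. fs.dim (polyfuns {1..m}) * fs.dim (polyfuns {1..n})
      \<le> C * fs.dim (polyfuns {1..m + n + K})"
    using dim_polyfuns_supermultiplicative by metis
  show ?thesis
  proof (rule convergent_root_supermultiplicative)
    show "graded_codimension n > 0" if "n \<ge> 1" for n
      unfolding graded_codimension_eq_dim by (rule dim_polyfuns_pos[OF that])
    show "graded_codimension m * graded_codimension n \<le> C * graded_codimension (m + n + K)" for m n
      unfolding graded_codimension_eq_dim by (rule super)
    show "graded_codimension n \<le> card Basis ^ (n + 1)" for n
      using dim_polyfuns_le[of "{1..n}"] unfolding graded_codimension_eq_dim by (simp add: mult.commute)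
  qed
qed

end

theorem corollary6p2:
  fixes scale :: "'f::field_char_0 \<Rightarrow> 'a::ab_group_add \<Rightarrow> 'a"
    and mult :: "'a \<Rightarrow> 'a \<Rightarrow> 'a"
    and T :: "'t set" and A :: "'t \<Rightarrow> 'a set"
  assumes "graded_algebra scale mult T A"
    and "\<exists>Basis. finite_dimensional_vector_space scale Basis"
    and "\<nexists>I. graded_algebra.nontrivial_graded_ideal scale mult T A I"
  shows "convergent (\<lambda>n. root n (real (graded_algebra.graded_codimension scale mult T A n)))"
proof -
  obtain Basis where "finite_dimensional_vector_space scale Basis" using assms(2) by blast
  then interpret fd_graded_algebra scale mult T A Basis
    using assms(1) by (intro fd_graded_algebra.intro)
  show ?thesis
  proof (cases "\<exists>x y. mult x y \<noteq> 0")
    case True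
    interpret fd_graded_simple_algebra scale mult T A Basis
      using assms(3) True by unfold_locales
    show ?thesis by (rule convergent_root_codimension)
  \<comment> \<open>With zero multiplication the codimensions vanish from \<open>n = 2\<close> on,
    and the limit is 0.\<close>
  next
    case False
    then have "root n (real (graded_codimension n)) = 0" if "n \<ge> 2" for n
      using graded_codimension_zero_mult[OF _ that] by simp
    then have "\<forall>\<^sub>F n in sequentially. 0 = root n (real (graded_codimension n))"
      by (intro eventually_sequentiallyI[of 2]) auto
    then have "(\<lambda>n. root n (real (graded_codimension n))) \<longlonglongrightarrow> 0"
      by (rule Lim_transform_eventually[OF tendsto_const])
    then show ?thesis by (rule convergentI)
  qed
qed

end
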